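(* Let $F(x,y,z)\in\mathbb{C}[x,y,z]$ be a homogeneous polynomial, let $C=Z(F)$ be the corresponding algebraic curve in $\mathbb{P}^2$, not containing the line at infinity $L^\infty=Z(z)$ as a component, and let $p\in C\cap L^\infty$. Then $$(Z(F_x)\cdot Z(F_y))_p\ \ge\ \mu(C,p)+(C\cdot L^\infty)_p-1 .$$
   Context: $\mathbb{P}^2$ is the complex projective plane with homogeneous coordinates $x,y,z$; $Z(F)$ denotes the zero scheme of $F$; $F_x,F_y,F_z$ are the partial derivatives. $(\cdot)_p$ denotes the local intersection number at $p$ (the dimension of the local ring at $p$ modulo the two local equations; it is $0$ if $p$ does not lie on both curves, and may be $\infty$). $\mu(C,p)$ is the Milnor number of $C$ at $p$: for $q=(q_x,q_y,q_z)\in\mathbb{P}^2$ let $F_{(q)}=q_xF_x+q_yF_y+q_zF_z$; then $\mu(C,p)=(Z(F_{(q')})\cdot Z(F_{(q'')}))_p$ for any $q',q''\in\mathbb{P}^2$ such that $p,q',q''$ are not collinear; this is the usual Milnor number of a local equation of $C$ at $p$ (zero at smooth points of $C$). *)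

theory Defs
  imports
    "HOL-Analysis.Cartesian_Space"
    "HOL-Computational_Algebra.Computational_Algebra"
    "HOL-Library.Extended_Nat"
begin

section \<open>Homogeneous polynomials in three variables\<close>

text \<open>\<open>\<complex>[x,y,z]\<close> is rendered as the iterated polynomial ring \<open>\<complex>[x][y][z]\<close>: the outermost
  variable is \<open>z\<close>, the innermost one is \<open>x\<close>.\<close>

type_synonym poly3 = "complex poly poly poly"

definition coeff3 :: "poly3 \<Rightarrow> nat \<Rightarrow> nat \<Rightarrow> nat \<Rightarrow> complex"
  where "coeff3 F i j k = coeff (coeff (coeff F k) j) i"

definition const3 :: "complex \<Rightarrow> poly3"
  where "const3 c = [:[:[:c:]:]:]"

definition varz :: poly3
  where "varz = [:0, 1:]"

definition eval3 :: "poly3 \<Rightarrow> complex ^ 3 \<Rightarrow> complex"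
  where "eval3 F p = poly (poly (poly F [:[:p $ 3:]:]) [:p $ 2:]) (p $ 1)"

definition Dx :: "poly3 \<Rightarrow> poly3"
  where "Dx F = map_poly (map_poly pderiv) F"

definition Dy :: "poly3 \<Rightarrow> poly3"
  where "Dy F = map_poly pderiv F"

definition Dz :: "poly3 \<Rightarrow> poly3"
  where "Dz F = pderiv F"

text \<open>The zero polynomial is homogeneous of every degree.\<close>

definition homogeneous :: "nat \<Rightarrow> poly3 \<Rightarrow> bool"
  where "homogeneous d F \<longleftrightarrow> (\<forall>i j k. coeff3 F i j k \<noteq> 0 \<longrightarrow> i + j + k = d)"

definition polar :: "poly3 \<Rightarrow> complex ^ 3 \<Rightarrow> poly3"
  where "polar F q = const3 (q $ 1) * Dx F + const3 (q $ 2) * Dy F + const3 (q $ 3) * Dz F"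


section \<open>Points of the projective plane\<close>

text \<open>A point of \<open>\<bbbP>\<^sup>2\<close> is given by a nonzero vector of homogeneous coordinates. A line is the zero
  set of a nonzero linear form \<open>l\<close>; a triple containing a zero vector is collinear in this sense.\<close>

definition collinear3 :: "complex ^ 3 \<Rightarrow> complex ^ 3 \<Rightarrow> complex ^ 3 \<Rightarrow> bool"
  where "collinear3 p q r \<longleftrightarrow>
    (\<exists>l :: complex ^ 3. l \<noteq> 0 \<and> (\<forall>v\<in>{p, q, r}. (\<Sum>i\<in>UNIV. l $ i * v $ i) = 0))"


section \<open>Local intersection numbers\<close>

text \<open>The local ring of \<open>\<bbbP>\<^sup>2\<close> at \<open>p\<close>: fractions of homogeneous polynomials of equal degree whose
  denominator does not vanish at \<open>p\<close>.\<close>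

definition local_ring :: "complex ^ 3 \<Rightarrow> poly3 fract set"
  where "local_ring p =
    {Fract G H | G H d. homogeneous d G \<and> homogeneous d H \<and> eval3 H p \<noteq> 0}"

text \<open>The local equations at \<open>p\<close> of the zero scheme of a homogeneous \<open>F\<close>. They differ by units of
  the local ring, so that all of them generate the same ideal.\<close>

definition local_equations :: "poly3 \<Rightarrow> complex ^ 3 \<Rightarrow> poly3 fract set"
  where "local_equations F p =
    {Fract F H | H d. homogeneous d F \<and> homogeneous d H \<and> eval3 H p \<noteq> 0}"

definition local_ideal :: "poly3 \<Rightarrow> poly3 \<Rightarrow> complex ^ 3 \<Rightarrow> poly3 fract set"
  where "local_ideal F G p =
    {a * f + b * g | a b f g. a \<in> local_ring p \<and> b \<in> local_ring p \<and>
       f \<in> local_equations F p \<and> g \<in> local_equations G p}"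

text \<open>The dimension over \<open>\<complex>\<close> of a quotient \<open>V / W\<close>, possibly infinite, as the supremum of the
  cardinalities of finite subsets of \<open>V\<close> that are linearly independent modulo \<open>W\<close>.\<close>

definition quotient_dim :: "poly3 fract set \<Rightarrow> poly3 fract set \<Rightarrow> enat"
  where "quotient_dim V W =
    (SUP B \<in> {B. finite B \<and> B \<subseteq> V \<and>
        (\<forall>c :: poly3 fract \<Rightarrow> complex.
           (\<Sum>b\<in>B. Fract (const3 (c b)) 1 * b) \<in> W \<longrightarrow> (\<forall>b\<in>B. c b = 0))}. enat (card B))"

definition intersection_number :: "poly3 \<Rightarrow> poly3 \<Rightarrow> complex ^ 3 \<Rightarrow> enat"
  where "intersection_number F G p = quotient_dim (local_ring p) (local_ideal F G p)"

text \<open>For homogeneous \<open>F\<close> and a point \<open>p\<close> of \<open>Z(F)\<close> the intersection number below does not depend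
  on the choice of \<open>q'\<close> and \<open>q''\<close>.\<close>

definition milnor_number :: "poly3 \<Rightarrow> complex ^ 3 \<Rightarrow> enat"
  where "milnor_number F p =
    (THE m. \<forall>q' q''. \<not> collinear3 p q' q'' \<longrightarrow>
       m = intersection_number (polar F q') (polar F q'') p)"

end

theory Submission
  imports Defs
begin

text \<open>Choose homogeneous coordinates in which \<open>p\<close> is the origin of an affine chart \<open>(y, z)\<close>, and let
  \<open>f(y, z)\<close> be the dehomogenized equation. The Milnor number is \<open>i(f\<^sub>y, f\<^sub>z)\<close>, and by Euler's
  identity the ideal of \<open>F\<^sub>x, F\<^sub>y\<close> is generated by \<open>f\<^sub>y\<close> and \<open>d f - y f\<^sub>y - z f\<^sub>z\<close>. Along a branch
  \<open>y = \<alpha>(t)\<close>, \<open>z = t\<^sup>N\<close> of \<open>f\<^sub>y = 0\<close> the chain rule gives \<open>t (d/dt) f = N z f\<^sub>z\<close>, so \<open>f\<close> and \<open>z f\<^sub>z\<close> have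
  the same order there, and the order of \<open>d f - y f\<^sub>y - z f\<^sub>z\<close> is at least as large. Summing
  over the branches yields
  \<open>i(f\<^sub>y, d f - y f\<^sub>y - z f\<^sub>z) \<ge> i(f\<^sub>y, z f\<^sub>z) = i(f\<^sub>y, z) + i(f\<^sub>y, f\<^sub>z)\<close> and \<open>i(f\<^sub>y, z) = i(f, z) - 1\<close>.
  The same argument gives Teissier's formula \<open>i(f\<^sub>y, f) = i(f\<^sub>y, z) + i(f\<^sub>y, f\<^sub>z)\<close>. Its other two terms
  depend on the first polar only, which shows that the Milnor number does not depend on the
  chart.\<close>

section \<open>Evaluation homomorphisms\<close>

text \<open>F_x and F_y span the polars with respect to the points of the line at infinity. This
  line is spanned by p and q, so the polars at q and at p generate the same ideal; this is why the
  chart has its origin at p and its y-axis at infinity. As C does not contain this line, f(y, 0) is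
  nonzero; it vanishes at the origin, so f_y(y, 0) is nonzero too, and every branch of f_y can be
  written with z = t^N. The obstacle is that multiplicities are dimensions, possibly infinite,
  whereas the argument compares orders along branches. The bridge is
  \<open>loc_mult_eq_branch_sum\<close>: N times the dimension is the sum of the orders in t over
  all branches of one of the curves. It is proved up to every finite truncation, so that infinite
  values are included. Teissier's formula needs a direction q such that the line pq is not inside C.
  For other directions the two polars are first replaced by another basis of their span, and two
  such pairs are then compared through a common third direction.\<close>

definition is_hom :: "('a::comm_ring_1 \<Rightarrow> 'b::comm_ring_1) \<Rightarrow> bool"
  where "is_hom h \<longleftrightarrow> h 0 = 0 \<and> h 1 = 1 \<and> (\<forall>a b. h (a + b) = h a + h b) \<and> (\<forall>a b. h (a * b) = h a * h b)"

text \<open>Nested use of this map gives \<open>emb\<close>, \<open>along\<close> and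
  \<open>dehom\<close>, so that one \<open>chain_rule\<close> yields both the derivative along a
  branch and the partial derivatives in a chart.\<close>

definition eval_hom :: "('a::comm_ring_1 \<Rightarrow> 'b::comm_ring_1) \<Rightarrow> 'b \<Rightarrow> 'a poly \<Rightarrow> 'b"
  where "eval_hom h X P = poly (map_poly h P) X"

lemma is_homD:
  assumes "is_hom h"
  shows "h 0 = 0" "h 1 = 1" "h (a + b) = h a + h b" "h (a * b) = h a * h b"
  using assms by (auto simp: is_hom_def)

lemma is_hom_minus:
  assumes "is_hom h"
  shows "h (- a) = - h a" "h (a - b) = h a - h b"
proof -
  show *: "h (- a) = - h a" for a
    using is_homD(1,3)[OF assms] by (metis add.right_inverse eq_neg_iff_add_eq_0 add.commute)
  show "h (a - b) = h a - h b"
    using is_homD(3)[OF assms, of a "- b"] * by simp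
qed

lemma is_hom_power: "is_hom h \<Longrightarrow> h (a ^ n) = h a ^ n"
  by (induction n) (auto simp: is_homD)

lemma is_hom_sum: "is_hom h \<Longrightarrow> h (sum f A) = (\<Sum>i\<in>A. h (f i))"
  by (induction A rule: infinite_finite_induct) (auto simp: is_homD)

lemma is_hom_of_nat: "is_hom h \<Longrightarrow> h (of_nat n) = of_nat n"
  by (induction n) (auto simp: is_homD)

lemma is_hom_comp: "is_hom h \<Longrightarrow> is_hom k \<Longrightarrow> is_hom (\<lambda>a. h (k a))"
  by (simp add: is_hom_def)

lemma eval_hom_0 [simp]: "eval_hom h X 0 = 0"
  by (simp add: eval_hom_def)

lemma eval_hom_pCons:
  "h 0 = 0 \<Longrightarrow> eval_hom h X (pCons a P) = h a + X * eval_hom h X P"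
  by (cases "a = 0 \<and> P = 0") (auto simp: eval_hom_def map_poly_pCons)

lemma is_hom_eval_hom:
  assumes h: "is_hom h"
  shows "is_hom (eval_hom h X)"
proof -
  note [simp] = is_homD[OF h]
  have add: "eval_hom h X (P + Q) = eval_hom h X P + eval_hom h X Q" for P Q
    by (induction P Q rule: poly_induct2) (auto simp: eval_hom_pCons algebra_simps)
  have smult: "eval_hom h X (smult c P) = h c * eval_hom h X P" for c P
    by (induction P) (auto simp: eval_hom_pCons algebra_simps)
  have "eval_hom h X (P * Q) = eval_hom h X P * eval_hom h X Q" for P Q
    by (induction P) (auto simp: eval_hom_pCons add smult algebra_simps)
  moreover have "eval_hom h X 1 = 1"
    by (simp add: one_pCons eval_hom_pCons)
  ultimately show ?thesis
    using add by (auto simp: is_hom_def)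
qed

lemma is_hom_map_poly:
  assumes h: "is_hom h"
  shows "is_hom (map_poly h)"
proof -
  note [simp] = is_homD[OF h]
  have "map_poly h (P * Q) = map_poly h P * map_poly h Q" for P Q
    by (intro poly_eqI) (simp add: coeff_map_poly coeff_mult is_hom_sum[OF h])
  moreover have "map_poly h (P + Q) = map_poly h P + map_poly h Q" for P Q
    by (intro poly_eqI) (simp add: coeff_map_poly)
  ultimately show ?thesis
    by (auto simp: is_hom_def)
qed

lemma map_poly_hom_simps:
  assumes h: "is_hom h"
  shows "map_poly h (P * Q) = map_poly h P * map_poly h Q"
    and "map_poly h (P + Q) = map_poly h P + map_poly h Q"
    and "map_poly h (pCons a P) = pCons (h a) (map_poly h P)"
  using is_homD[OF is_hom_map_poly[OF h]] is_homD(1)[OF h]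
  by (auto simp: map_poly_pCons)

lemma is_hom_poly: "is_hom (\<lambda>P. poly P a)"
  by (simp add: is_hom_def)

lemma hom_ext_poly:
  assumes h: "is_hom h" and k: "is_hom k"
    and "\<And>a. h [:a:] = k [:a:]" and "h [:0, 1:] = k [:0, 1:]"
  shows "h P = k P"
proof (induction P)
  case 0
  show ?case by (simp add: is_homD[OF h] is_homD[OF k])
next
  case (pCons a P)
  have "pCons a P = [:a:] + [:0, 1:] * P" by simp
  then show ?case
    using assms pCons by (simp only: is_homD[OF h] is_homD[OF k])
qed

lemma hom_eval_hom:
  assumes k: "is_hom k" and h: "is_hom h"
  shows "k (eval_hom h X P) = eval_hom (\<lambda>a. k (h a)) (k X) P"
  by (induction P) (auto simp: eval_hom_pCons is_homD[OF k] is_homD[OF h])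

lemma eval_hom_pcompose:
  assumes h: "is_hom h"
  shows "eval_hom h X (P \<circ>\<^sub>p Q) = eval_hom h (eval_hom h X Q) P"
proof (induction P)
  case (pCons a P)
  then show ?case
    using is_homD[OF is_hom_eval_hom[OF h, of X]]
    by (simp add: pcompose_pCons eval_hom_pCons is_homD[OF h])
qed simp

lemma eval_hom_altdef:
  assumes h0: "h 0 = 0" and "degree P \<le> n"
  shows "eval_hom h X P = (\<Sum>k\<le>n. h (coeff P k) * X ^ k)"
proof -
  have "degree (map_poly h P) \<le> n"
    using assms(2) by (intro degree_le) (auto simp: coeff_map_poly h0 coeff_eq_0)
  then have "poly (map_poly h P) X = (\<Sum>k\<le>n. coeff (map_poly h P) k * X ^ k)"
    unfolding poly_altdef by (intro sum.mono_neutral_left) (auto simp: coeff_eq_0)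
  then show ?thesis
    using h0 by (simp add: eval_hom_def coeff_map_poly)
qed

text \<open>Induction on \<open>P\<close> by the Leibniz rule for the derivation \<open>D\<close>.
  The two slots hold the derivatives of the coefficients with respect to inner variables: three
  nested variables fill both, fewer variables put 0 there.\<close>

lemma chain_rule:
  assumes h: "is_hom h"
    and add: "\<And>a b. D (a + b) = D a + D b" and mult: "\<And>a b. D (a * b) = a * D b + D a * b"
    and Dh: "\<And>a. D (h a) = h (\<delta>1 a) * E1 + h (\<delta>2 a) * E2"
    and \<delta>: "\<delta>1 0 = 0" "\<delta>2 0 = 0"
  shows "D (eval_hom h X P) =
    eval_hom h X (map_poly \<delta>1 P) * E1 + eval_hom h X (map_poly \<delta>2 P) * E2
    + eval_hom h X (pderiv P) * D X"
proof (induction P)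
  case 0
  show ?case using Dh[of 0] by (simp add: \<delta> is_homD[OF h])
next
  case (pCons a P)
  show ?case
    by (simp add: eval_hom_pCons is_homD[OF h] add mult Dh pCons map_poly_pCons pderiv_pCons \<delta>
       is_homD[OF is_hom_eval_hom[OF h]] algebra_simps del: pCons_0_0)
qed

section \<open>Roots of polynomials over formal power series\<close>

text \<open>The substitution of t^N for t. It turns Puiseux series in t^(1/N) into power series and
  so avoids fractional exponents.\<close>

definition ramify :: "nat \<Rightarrow> complex fps \<Rightarrow> complex fps"
  where "ramify N c = c oo fps_X ^ N"

lemma is_hom_ramify: "N > 0 \<Longrightarrow> is_hom (ramify N)"
  by (auto simp: is_hom_def ramify_def fps_compose_add_distrib fps_compose_mult_distrib)

lemma ramify_nth_0 [simp]: "fps_nth (ramify N c) 0 = fps_nth c 0"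
  by (simp add: ramify_def)

lemma ramify_const [simp]: "ramify N (fps_const c) = fps_const c"
  by (simp add: ramify_def)

lemma ramify_X_power: "N > 0 \<Longrightarrow> ramify N (fps_X ^ k) = fps_X ^ (N * k)"
  by (simp add: ramify_def fps_X_power_compose power_mult)

lemma ramify_ramify: "N > 0 \<Longrightarrow> M > 0 \<Longrightarrow> ramify M (ramify N c) = ramify (N * M) c"
proof -
  assume "N > 0" "M > 0"
  then have "c oo (fps_X ^ N oo fps_X ^ M) = c oo fps_X ^ N oo fps_X ^ M"
    by (intro fps_compose_assoc) auto
  moreover have "fps_X ^ N oo fps_X ^ M = (fps_X ^ (N * M) :: complex fps)"
    using \<open>M > 0\<close> by (subst fps_X_power_compose) (simp_all add: mult.commute flip: power_mult)
  ultimately show ?thesis by (simp add: ramify_def)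
qed

lemma is_hom_fps_nth_0: "is_hom (\<lambda>c :: complex fps. fps_nth c 0)"
  by (simp add: is_hom_def)

lemma poly_diff_factor:
  fixes P :: "'a::comm_ring_1 poly"
  shows "\<exists>R. poly P (a + d) = poly P a + d * R"
proof (induction P)
  case (pCons c P)
  then obtain R where "poly P (a + d) = poly P a + d * R" by auto
  then have "poly (pCons c P) (a + d) = poly (pCons c P) a + d * (poly P a + (a + d) * R)"
    by (simp add: algebra_simps)
  then show ?case by blast
qed (auto intro: exI[of _ 0])

lemma poly_taylor2:
  fixes P :: "'a::idom poly"
  shows "\<exists>R. poly P (a + d) = poly P a + d * poly (pderiv P) a + d ^ 2 * R"
proof (induction P)
  case (pCons c P)
  then obtain R where "poly P (a + d) = poly P a + d * poly (pderiv P) a + d ^ 2 * R" by auto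
  then have "poly (pCons c P) (a + d) = poly (pCons c P) a + d * poly (pderiv (pCons c P)) a
      + d ^ 2 * (poly (pderiv P) a + (a + d) * R)"
    by (simp add: algebra_simps pderiv_pCons power2_eq_square)
  then show ?case by blast
qed (auto intro: exI[of _ 0])

lemma poly_nth_0:
  fixes G :: "complex fps poly"
  assumes "fps_nth b 0 = 0"
  shows "fps_nth (poly G b) 0 = fps_nth (coeff G 0) 0"
  using assms by (cases G) simp

text \<open>Hensel's lemma, by a Newton iteration that corrects one coefficient per stage. The
  divisor is the fixed number \<gamma>, because the derivative at each \<open>B n\<close> has this
  constant term.\<close>

lemma fps_simple_root:
  fixes G :: "complex fps poly"
  assumes G0: "fps_nth (coeff G 0) 0 = 0" and G1: "fps_nth (coeff G 1) 0 \<noteq> 0"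
  obtains b where "fps_nth b 0 = 0" "poly G b = 0"
proof -
  define \<gamma> where "\<gamma> = fps_nth (coeff G 1) 0"
  define B where "B = rec_nat 0 (\<lambda>n b. b - fps_const (fps_nth (poly G b) (Suc n) / \<gamma>) * fps_X ^ Suc n)"
  have B0 [simp]: "B 0 = 0" by (simp add: B_def)
  have BS: "B (Suc n) = B n - fps_const (fps_nth (poly G (B n)) (Suc n) / \<gamma>) * fps_X ^ Suc n" for n
    by (simp add: B_def)
  have Bconst: "fps_nth (B n) 0 = 0" for n
    by (induction n) (auto simp: BS)
  have approx: "fps_nth (poly G (B n)) k = 0" if "k \<le> n" for n k
    using that
  proof (induction n arbitrary: k)
    case 0
    then show ?case using G0 by (simp add: poly_nth_0)
  next
    case (Suc n)
    define e where "e = - fps_const (fps_nth (poly G (B n)) (Suc n) / \<gamma>)"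
    obtain R where R: "poly G (B n + e * fps_X ^ Suc n) = poly G (B n)
        + e * fps_X ^ Suc n * poly (pderiv G) (B n) + (e * fps_X ^ Suc n) ^ 2 * R"
      using poly_taylor2 by blast
    have step: "B (Suc n) = B n + e * fps_X ^ Suc n"
      by (simp add: BS e_def)
    \<comment> \<open>The quadratic Taylor term starts at t^(2 n + 2), so it does not touch the
      coefficients up to n + 1.\<close>
    have sq: "(e * fps_X ^ Suc n) ^ 2 = fps_X ^ (2 * Suc n) * e ^ 2"
      unfolding power_mult_distrib mult.commute[of 2 "Suc n"] power_mult by (rule mult.commute)
    have "poly G (B (Suc n)) = poly G (B n) + fps_X ^ Suc n * (e * poly (pderiv G) (B n))
        + fps_X ^ (2 * Suc n) * (e ^ 2 * R)"
      unfolding step R sq by (simp only: mult_ac)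
    moreover have "k < 2 * Suc n" using Suc.prems by simp
    ultimately have eq: "fps_nth (poly G (B (Suc n))) k = fps_nth (poly G (B n)) k
        + (if k < Suc n then 0 else fps_nth (e * poly (pderiv G) (B n)) (k - Suc n))"
      using \<open>k < 2 * Suc n\<close> by (simp add: fps_X_power_mult_nth del: power_Suc mult_Suc_right)
    show ?case
    proof (cases "k \<le> n")
      case True
      then show ?thesis using eq Suc.IH by simp
    next
      case False
      then have "k = Suc n" using Suc.prems by simp
      moreover have "fps_nth (poly (pderiv G) (B n)) 0 = \<gamma>"
        by (simp add: poly_nth_0 Bconst \<gamma>_def coeff_pderiv)
      ultimately show ?thesis
        using G1 unfolding eq by (simp add: e_def \<gamma>_def)
    qed
  qed
  \<comment> \<open>Stage \<open>k\<close> fixes the coefficient of t^k for good, so the diagonal is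
    the limit of the \<open>B n\<close>.\<close>
  define b where "b = Abs_fps (\<lambda>k. fps_nth (B k) k)"
  have stab: "fps_nth (B (k + m)) k = fps_nth (B k) k" for m k
    by (induction m) (auto simp: BS)
  have "poly G b = 0"
  proof (rule fps_ext)
    fix n
    define S where "S = fps_shift (Suc n) (b - B n)"
    have S: "b - B n = fps_X ^ Suc n * S"
    proof (rule fps_ext)
      fix k
      show "fps_nth (b - B n) k = fps_nth (fps_X ^ Suc n * S) k"
        using stab[of k "n - k"]
        by (auto simp: S_def fps_X_power_mult_nth b_def simp del: power_Suc)
    qed
    obtain R where "poly G (B n + (b - B n)) = poly G (B n) + (b - B n) * R"
      using poly_diff_factor by blast
    then have "poly G b = poly G (B n) + (b - B n) * R" by simp
    also have "\<dots> = poly G (B n) + fps_X ^ Suc n * (S * R)"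
      by (subst S) (simp only: mult.assoc)
    finally have "fps_nth (poly G b) n = fps_nth (poly G (B n)) n"
      by (simp add: fps_X_power_mult_nth del: power_Suc)
    then show "fps_nth (poly G b) n = fps_nth 0 n"
      using approx by simp
  qed
  moreover have "fps_nth b 0 = 0" by (simp add: b_def)
  ultimately show thesis using that by blast
qed

abbreviation red0 :: "complex fps poly \<Rightarrow> complex poly"
  where "red0 \<equiv> map_poly (\<lambda>c. fps_nth c 0)"

lemma coeff_pcompose_shift:
  fixes G :: "'a::{idom, semiring_char_0} poly"
  shows "fact k * coeff (G \<circ>\<^sub>p [:b, 1:]) k = poly ((pderiv ^^ k) G) b"
proof -
  have "(pderiv ^^ k) (G \<circ>\<^sub>p [:b, 1:]) = (pderiv ^^ k) G \<circ>\<^sub>p [:b, 1:]"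
    by (induction k) (auto simp: pderiv_pcompose pderiv_pCons)
  then have "coeff ((pderiv ^^ k) (G \<circ>\<^sub>p [:b, 1:])) 0 = poly ((pderiv ^^ k) G) b"
    by (simp add: poly_pcompose flip: poly_0_coeff_0)
  then show ?thesis
    by (simp add: coeff_higher_pderiv pochhammer_fact)
qed

text \<open>Translating by a root of the derivative of order \<open>r - 1\<close> kills the coefficient of
  \<open>y\<close> to the power \<open>r - 1\<close>, so that the initial form of the Newton polygon cannot be the
  \<open>r\<close>-th power of a linear form.\<close>

lemma tschirnhaus:
  fixes G :: "complex fps poly"
  assumes low: "\<And>k. k < r \<Longrightarrow> fps_nth (coeff G k) 0 = 0" and r: "fps_nth (coeff G r) 0 \<noteq> 0" "r > 0"
  obtains b where "fps_nth b 0 = 0"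
    "\<And>k. fps_nth (coeff (G \<circ>\<^sub>p [:b, 1:]) k) 0 = fps_nth (coeff G k) 0"
    "coeff (G \<circ>\<^sub>p [:b, 1:]) (r - 1) = 0"
proof -
  \<comment> \<open>At t = 0 this derivative has a simple zero in y at 0, which
    \<open>fps_simple_root\<close> lifts to the translation \<open>b\<close>.\<close>
  define H where "H = (pderiv ^^ (r - 1)) G"
  have fps_fact: "fact k = fps_const (fact k :: complex)" for k
    by (metis fps_of_nat of_nat_fact)
  have poch: "pochhammer (of_nat n) k = fps_const (pochhammer (of_nat n :: complex) k)" for n k
    by (induction k) (auto simp: pochhammer_Suc simp flip: fps_of_nat)
  have H: "fps_nth (coeff H k) 0 = pochhammer (of_nat (Suc k)) (r - 1) * fps_nth (coeff G (k + (r - 1))) 0" for k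
    unfolding H_def coeff_higher_pderiv poch by simp
  have "fps_nth (coeff H 0) 0 = 0"
    using low[of "r - 1"] r unfolding H by simp
  moreover have "fps_nth (coeff H 1) 0 \<noteq> 0"
  proof -
    have "pochhammer (of_nat (Suc 1) :: complex) (r - 1) = of_nat (pochhammer (Suc 1) (r - 1))"
      by (rule pochhammer_of_nat)
    moreover have "pochhammer (Suc 1) (r - 1) > 0"
      by (rule pochhammer_pos) simp
    moreover have "1 + (r - 1) = r" using r by simp
    ultimately show ?thesis
      using r unfolding H by (metis mult_eq_0_iff of_nat_eq_0_iff less_irrefl)
  qed
  ultimately obtain b where b: "fps_nth b 0 = 0" "poly H b = 0"
    using fps_simple_root by blast
  show thesis
  proof (rule that[OF b(1)])
    show "coeff (G \<circ>\<^sub>p [:b, 1:]) (r - 1) = 0"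
      using b(2) coeff_pcompose_shift[of "r - 1" G b] by (simp add: H_def)
  next
    fix k
    have "fact k * fps_nth (coeff (G \<circ>\<^sub>p [:b, 1:]) k) 0 = fps_nth (poly ((pderiv ^^ k) G) b) 0"
      using arg_cong[OF coeff_pcompose_shift[of k G b], of "\<lambda>c. fps_nth c 0"] by (simp add: fps_fact)
    also have "\<dots> = fact k * fps_nth (coeff G k) 0"
      using b(1) poch[of 1 k] by (simp add: poly_nth_0 coeff_higher_pderiv pochhammer_fact fps_fact)
    finally show "fps_nth (coeff (G \<circ>\<^sub>p [:b, 1:]) k) 0 = fps_nth (coeff G k) 0" by simp
  qed
qed

text \<open>If a root \<xi> had multiplicity r, then P = c (y - \<xi>)^r. Its coefficient -r c \<xi>
  of y^(r-1) vanishes only for \<xi> = 0, and then no lower coefficient survives. This makes the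
  order drop in the Newton-Puiseux induction.\<close>

lemma root_of_low_order:
  fixes P :: "complex poly"
  assumes "degree P = r" "r > 0" "coeff P (r - 1) = 0" and k: "k < r" "coeff P k \<noteq> 0"
  obtains \<xi> u m where "P = [:-\<xi>, 1:] ^ m * u" "poly u \<xi> \<noteq> 0" "0 < m" "m < r"
proof -
  have P0: "P \<noteq> 0" using k by auto
  obtain \<xi> where \<xi>: "poly P \<xi> = 0"
    using fundamental_theorem_of_algebra_alt[of P] assms
    by (metis degree_pCons_0 less_numeral_extra(3))
  define m where "m = order \<xi> P"
  obtain u where u: "P = [:-\<xi>, 1:] ^ m * u" "\<not> [:-\<xi>, 1:] dvd u"
    using order_decomp[OF P0, of \<xi>] by (auto simp: m_def)
  have "u \<noteq> 0" using P0 u by auto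
  then have deg: "degree P = m + degree u"
    using u(1) by (simp add: degree_mult_eq degree_linear_power)
  have "m < r"
  proof (rule ccontr)
    assume "\<not> m < r"
    with deg assms have "m = r" "degree u = 0" by auto
    then obtain c where c: "u = [:c:]" by (metis degree_eq_zeroE)
    have co: "coeff P i = c * (of_nat (r choose i) * (- \<xi>) ^ (r - i))" if "i \<le> r" for i
      using that by (simp add: u(1) c \<open>m = r\<close> coeff_linear_poly_power)
    have "c * (of_nat r * (- \<xi>)) = 0"
      using co[of "r - 1"] assms(2,3) by (cases r) auto
    moreover have "c \<noteq> 0" using \<open>u \<noteq> 0\<close> c by simp
    ultimately have "\<xi> = 0" using assms(2) by simp
    then show False using co[of k] k by simp
  qed
  moreover have "m > 0" using \<xi> P0 by (simp add: m_def order_root)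
  ultimately show thesis using that[of \<xi> m u] u by (auto simp: poly_eq_0_iff_dvd)
qed

lemma coeff_X_power_mult: "coeff ([:0, 1:] ^ r * u) k = (if k < r then 0 else coeff u (k - r))"
  for u :: "complex poly"
proof -
  have "[:0, 1:] ^ r * u = monom 1 r * u"
    by (simp only: monom_altdef smult_1_left)
  then show ?thesis by (simp only: coeff_monom_mult) simp
qed

text \<open>The order r in y drops strictly in each round of the Newton polygon method, because the
  translation of \<open>tschirnhaus\<close> excludes a root of full multiplicity. So finitely many
  rounds suffice, and the only limit taken is the one in \<open>fps_simple_root\<close>.\<close>

lemma newton_puiseux_root:
  fixes G :: "complex fps poly"
  assumes "\<And>k. k < r \<Longrightarrow> fps_nth (coeff G k) 0 = 0" and "fps_nth (coeff G r) 0 \<noteq> 0" and "r > 0"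
  shows "\<exists>N>0. \<exists>\<alpha>. fps_nth \<alpha> 0 = 0 \<and> eval_hom (ramify N) \<alpha> G = 0"
  using assms
proof (induction r arbitrary: G rule: less_induct)
  case (less r)
  obtain b where b: "fps_nth b 0 = 0" 
    "\<And>k. fps_nth (coeff (G \<circ>\<^sub>p [:b, 1:]) k) 0 = fps_nth (coeff G k) 0"
    "coeff (G \<circ>\<^sub>p [:b, 1:]) (r - 1) = 0"
    using tschirnhaus[of r G] less.prems by blast
  define H where "H = G \<circ>\<^sub>p [:b, 1:]"
  have lowH: "k < r \<Longrightarrow> fps_nth (coeff H k) 0 = 0" and rH: "fps_nth (coeff H r) 0 \<noteq> 0" for k
    using less.prems b by (auto simp: H_def)
  have reduce: "eval_hom (ramify N) (ramify N b + \<alpha>) G = 0"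
    if "eval_hom (ramify N) \<alpha> H = 0" "N > 0" for N \<alpha>
  proof -
    have hom: "is_hom (ramify N)" using that is_hom_ramify by blast
    have "eval_hom (ramify N) \<alpha> [:b, 1:] = ramify N b + \<alpha>"
      by (simp add: eval_hom_pCons is_homD[OF hom])
    then show ?thesis
      using that eval_hom_pcompose[OF hom, of \<alpha> G "[:b, 1:]"] by (simp add: H_def)
  qed
  show ?case
  proof (cases "\<forall>k<r. coeff H k = 0")
    case True
    \<comment> \<open>Here \<open>H\<close> is divisible by y^r, so 0 is a root of \<open>H\<close>
      and the translation itself is a root of \<open>G\<close>.\<close>
    then have "eval_hom (ramify 1) 0 H = 0"
      using less.prems(3) by (cases H) (auto simp: eval_hom_pCons ramify_def)
    then have "eval_hom (ramify 1) (ramify 1 b + 0) G = 0"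
      by (rule reduce) simp
    then show ?thesis using b(1) by (intro exI[of _ 1] conjI exI[of _ "ramify 1 b + 0"]) auto
  next
    case False
    \<comment> \<open>The minimum of s k / (r - k) is the slope of the edge of the Newton polygon
      that ends at (r, 0). If it is a / q, then replacing t by t^q and y by t^a w makes every term
      divisible by t^(a r).\<close>
    define s where "s k = subdegree (coeff H k)" for k
    define K where "K = {k. k < r \<and> coeff H k \<noteq> 0}"
    have "finite K" "K \<noteq> {}" using False by (auto simp: K_def)
    then obtain k0 where "is_arg_min (\<lambda>k. real (s k) / real (r - k)) (\<lambda>k. k \<in> K) k0"
      using ex_is_arg_min_if_finite by blast
    then have k0: "k0 \<in> K"
      and min: "\<And>k. k \<in> K \<Longrightarrow> real (s k0) / real (r - k0) \<le> real (s k) / real (r - k)"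
      by (auto simp: is_arg_min_linorder)
    define a where "a = s k0"
    define q where "q = r - k0"
    have k0r: "k0 < r" "coeff H k0 \<noteq> 0" using k0 by (auto simp: K_def)
    have "q > 0" using k0r by (simp add: q_def)
    have "a > 0"
      using k0r lowH[of k0] unfolding a_def s_def by (metis gr0I nth_subdegree_nonzero)
    have slope: "a * (r - k) \<le> q * s k" if "k < r" "coeff H k \<noteq> 0" for k
    proof -
      have "real a / real q \<le> real (s k) / real (r - k)"
        using min[of k] that by (simp add: K_def a_def q_def)
      then have "real (a * (r - k)) \<le> real (q * s k)"
        using that \<open>q > 0\<close> by (simp add: field_simps)
      then show ?thesis by (simp only: of_nat_le_iff)
    qed
    have homq: "is_hom (ramify q)" using \<open>q > 0\<close> is_hom_ramify by blast
    \<comment> \<open>The coefficient of w^k after division by t^(a r). Below r a power of t has to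
      be split off, which \<open>slope\<close> permits; from r on a power of t remains.\<close>
    define e where "e k = (if k < r then fps_shift (a * (r - k)) (ramify q (coeff H k))
      else ramify q (coeff H k) * fps_X ^ (a * (k - r)))" for k
    have sub: "subdegree (ramify q c) = q * subdegree c" for c
      using \<open>q > 0\<close> by (simp add: ramify_def mult.commute)
    have e: "ramify q (coeff H k) * fps_X ^ (a * k) = fps_X ^ (a * r) * e k" for k
    proof (cases "k < r")
      case True
      have A: "fps_X ^ (a * (r - k)) * fps_shift (a * (r - k)) (ramify q (coeff H k)) = ramify q (coeff H k)"
      proof (cases "coeff H k = 0")
        case False
        then have "a * (r - k) \<le> subdegree (ramify q (coeff H k))"
          using slope[OF True False] by (simp add: sub s_def)
        then show ?thesis
          by (subst mult.commute) (rule fps_shift_times_fps_X_power)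
      qed (simp add: is_homD[OF homq])
      have "ramify q (coeff H k) * fps_X ^ (a * k)
          = fps_X ^ (a * k) * (fps_X ^ (a * (r - k)) * fps_shift (a * (r - k)) (ramify q (coeff H k)))"
        by (subst A) (rule mult.commute)
      also have "\<dots> = fps_X ^ (a * k + a * (r - k)) * fps_shift (a * (r - k)) (ramify q (coeff H k))"
        by (simp only: power_add mult.assoc)
      also have "a * k + a * (r - k) = a * r"
        using True by (simp flip: distrib_left)
      finally show ?thesis
        using True by (simp only: e_def if_True)
    next
      case False
      then have "fps_X ^ (a * k) = (fps_X ^ (a * r) * fps_X ^ (a * (k - r)) :: complex fps)"
        by (simp flip: power_add distrib_left)
      then show ?thesis using False by (simp only: e_def if_False mult_ac)
    qed
    define D where "D = degree H"
    have rD: "r \<le> D" unfolding D_def using rH by (intro le_degree) auto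
    define Q where "Q = (\<Sum>k\<le>D. monom (e k) k)"
    have e0: "e k = 0" if "coeff H k = 0" for k
      using that by (simp add: e_def is_homD[OF homq])
    have coeffQ: "coeff Q k = e k" for k
      using e0[of k] by (auto simp: Q_def coeff_sum if_distrib D_def coeff_eq_0 cong: if_cong)
    \<comment> \<open>The polynomial of the edge. Its degree is r because the terms beyond r carry a
      positive power of t; it has no term in w^(r-1) by the translation, and the vertex at
      \<open>k0\<close> gives a nonzero lower term. So \<open>root_of_low_order\<close>
      applies.\<close>
    define P where "P = red0 Q"
    have coeffP: "coeff P k = fps_nth (e k) 0" for k
      by (simp add: P_def coeff_map_poly coeffQ)
    have "coeff P r \<noteq> 0" using rH by (simp add: coeffP e_def)
    moreover have "coeff P k = 0" if "k > r" for k
      using that \<open>a > 0\<close> by (simp add: coeffP e_def)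
    ultimately have "degree P = r"
      by (metis le_degree degree_le le_antisym)
    moreover have "coeff P (r - 1) = 0"
      using b(3) e0 by (simp add: coeffP H_def)
    moreover have "coeff P k0 \<noteq> 0"
    proof -
      have "coeff P k0 = fps_nth (ramify q (coeff H k0)) (a * q)"
        using k0r by (simp add: coeffP e_def q_def)
      also have "a * q = subdegree (ramify q (coeff H k0))"
        by (simp add: sub a_def s_def mult.commute)
      also have "fps_nth (ramify q (coeff H k0)) \<dots> \<noteq> 0"
      proof (rule nth_subdegree_nonzero)
        show "ramify q (coeff H k0) \<noteq> 0"
          using k0r \<open>q > 0\<close> by (simp add: ramify_def fps_compose_eq_0_iff)
      qed
      finally show ?thesis .
    qed
    ultimately obtain \<xi> u m where m: "P = [:-\<xi>, 1:] ^ m * u" "poly u \<xi> \<noteq> 0" "0 < m" "m < r"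
      using root_of_low_order[of P r k0] less.prems(3) k0r by blast
    \<comment> \<open>Moving the root \<xi> to the origin leaves the order m < r at t = 0, where the
      induction hypothesis applies.\<close>
    define R where "R = Q \<circ>\<^sub>p [:fps_const \<xi>, 1:]"
    have "red0 R = P \<circ>\<^sub>p [:\<xi>, 1:]"
    proof -
      have "red0 (smult c S) = smult (fps_nth c 0) (red0 S)" for c S
        by (intro poly_eqI) (simp add: coeff_map_poly)
      then
      have "red0 (S \<circ>\<^sub>p [:fps_const \<xi>, 1:]) = red0 S \<circ>\<^sub>p [:\<xi>, 1:]" for S
        by (induction S) (auto simp: pcompose_pCons map_poly_hom_simps[OF is_hom_fps_nth_0])
      then show ?thesis by (simp add: R_def P_def)
    qed
    also have "\<dots> = [:0, 1:] ^ m * (u \<circ>\<^sub>p [:\<xi>, 1:])"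
    proof -
      have "is_hom (\<lambda>S. S \<circ>\<^sub>p [:\<xi>, 1:])"
        by (simp add: is_hom_def pcompose_mult pcompose_add pcompose_1)
      then have "[:-\<xi>, 1:] ^ m \<circ>\<^sub>p [:\<xi>, 1:] = ([:-\<xi>, 1:] \<circ>\<^sub>p [:\<xi>, 1:]) ^ m"
        by (rule is_hom_power)
      then show ?thesis
        by (simp add: m(1) pcompose_mult pcompose_pCons)
    qed
    finally have redR: "red0 R = [:0, 1:] ^ m * (u \<circ>\<^sub>p [:\<xi>, 1:])" .
    have R: "fps_nth (coeff R k) 0 = (if k < m then 0 else coeff (u \<circ>\<^sub>p [:\<xi>, 1:]) (k - m))" for k
      using arg_cong[OF redR, of "\<lambda>p. coeff p k"] unfolding coeff_X_power_mult
      by (simp add: coeff_map_poly)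
    have "\<exists>N>0. \<exists>\<alpha>. fps_nth \<alpha> 0 = 0 \<and> eval_hom (ramify N) \<alpha> R = 0"
    proof (rule less.IH[OF m(4)])
      show "fps_nth (coeff R m) 0 \<noteq> 0"
        using m(2) by (simp add: R poly_pcompose flip: poly_0_coeff_0)
    qed (use R m in auto)
    then obtain N \<alpha> where N: "N > 0" "fps_nth \<alpha> 0 = 0" "eval_hom (ramify N) \<alpha> R = 0" by blast
    have homN: "is_hom (ramify N)" using N is_hom_ramify by blast
    define w where "w = fps_const \<xi> + \<alpha>"
    have "eval_hom (ramify N) w Q = 0"
      using N(3) eval_hom_pcompose[OF homN, of \<alpha> Q "[:fps_const \<xi>, 1:]"]
      by (simp add: R_def w_def eval_hom_pCons is_homD[OF homN])
    moreover have "degree Q \<le> D"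
      unfolding Q_def by (rule degree_sum_le) (auto intro: order_trans[OF degree_monom_le])
    ultimately have Qw: "(\<Sum>k\<le>D. ramify N (e k) * w ^ k) = 0"
      using eval_hom_altdef[of "ramify N" Q D w] by (simp add: is_homD[OF homN] coeffQ)
    have eN: "ramify (q * N) (coeff H k) * fps_X ^ (N * a * k) = fps_X ^ (N * a * r) * ramify N (e k)" for k
      using arg_cong[OF e[of k], of "ramify N"] N(1) \<open>q > 0\<close>
      by (simp add: is_homD[OF homN] ramify_ramify ramify_X_power mult_ac)
    \<comment> \<open>The substitution is undone: ramifying by N turns t^a w into t^(N a) times the
      root \<open>w\<close> of \<open>Q\<close>.\<close>
    have "eval_hom (ramify (q * N)) (fps_X ^ (N * a) * w) H
        = (\<Sum>k\<le>D. ramify (q * N) (coeff H k) * (fps_X ^ (N * a) * w) ^ k)"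
      using N(1) \<open>q > 0\<close> by (intro eval_hom_altdef) (auto simp: D_def is_homD[OF is_hom_ramify])
    also have "\<dots> = (\<Sum>k\<le>D. fps_X ^ (N * a * r) * (ramify N (e k) * w ^ k))"
      by (intro sum.cong refl) (simp add: power_mult_distrib eN flip: power_mult mult.assoc)
    also have "\<dots> = 0"
      using Qw by (simp flip: sum_distrib_left)
    finally have "eval_hom (ramify (q * N)) (fps_X ^ (N * a) * w) H = 0" .
    then have "eval_hom (ramify (q * N)) (ramify (q * N) b + fps_X ^ (N * a) * w) G = 0"
      using reduce N(1) \<open>q > 0\<close> by simp
    moreover have "fps_nth (ramify (q * N) b + fps_X ^ (N * a) * w) 0 = 0"
      using b(1) N(1) \<open>a > 0\<close> by simp
    ultimately show ?thesis using N(1) \<open>q > 0\<close> by (metis nat_0_less_mult_iff)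
  qed
qed

text \<open>Each root that is split off lowers r by one and may force a further ramification, so the
  indices multiply. The roots away from the origin stay in the factor \<open>U\<close>, which is a
  unit there.\<close>

lemma puiseux_factorization:
  fixes G :: "complex fps poly"
  assumes "\<And>k. k < r \<Longrightarrow> fps_nth (coeff G k) 0 = 0" and "fps_nth (coeff G r) 0 \<noteq> 0"
  shows "\<exists>N>0. \<exists>as U. (\<forall>\<alpha>\<in>set as. fps_nth \<alpha> 0 = 0) \<and> fps_nth (coeff U 0) 0 \<noteq> 0 \<and>
    map_poly (ramify N) G = U * (\<Prod>\<alpha>\<leftarrow>as. [:-\<alpha>, 1:])"
  using assms
proof (induction r arbitrary: G)
  case 0
  have "map_poly (ramify 1) G = G * (\<Prod>\<alpha>\<leftarrow>[]. [:-\<alpha>, 1:])"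
    by (intro poly_eqI) (simp add: coeff_map_poly ramify_def)
  then show ?case
    using 0 by (intro exI[of _ 1] conjI exI[of _ "[]"] exI[of _ G]) auto
next
  case (Suc r)
  obtain N \<alpha> where N: "N > 0" "fps_nth \<alpha> 0 = 0" "eval_hom (ramify N) \<alpha> G = 0"
    using newton_puiseux_root[of "Suc r" G] Suc.prems by blast
  then obtain H where H: "map_poly (ramify N) G = [:-\<alpha>, 1:] * H"
    unfolding eval_hom_def poly_eq_0_iff_dvd by blast
  have "ramify N 0 = 0" by (simp add: ramify_def)
  \<comment> \<open>At t = 0 the factor y - \<alpha> becomes y, so dividing by it shifts the
    constant terms of the coefficients down by one index.\<close>
  then have "fps_nth (coeff G (Suc k)) 0 = fps_nth (coeff ([:-\<alpha>, 1:] * H) (Suc k)) 0" for k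
    unfolding H [symmetric] by (simp add: coeff_map_poly)
  then have coeffH: "fps_nth (coeff H k) 0 = fps_nth (coeff G (Suc k)) 0" for k
    using N(2) by simp
  obtain M as U where M: "M > 0" "\<forall>\<alpha>\<in>set as. fps_nth \<alpha> 0 = 0" "fps_nth (coeff U 0) 0 \<noteq> 0"
    "map_poly (ramify M) H = U * (\<Prod>\<alpha>\<leftarrow>as. [:-\<alpha>, 1:])"
    using Suc.IH[of H] Suc.prems by (auto simp: coeffH)
  have homM: "is_hom (ramify M)" using M is_hom_ramify by blast
  have "map_poly (ramify (N * M)) G = map_poly (ramify M) (map_poly (ramify N) G)"
    using N(1) M(1) by (intro poly_eqI) (simp add: coeff_map_poly ramify_ramify is_homD[OF is_hom_ramify])
  also have "\<dots> = U * (\<Prod>\<alpha>\<leftarrow>ramify M \<alpha> # as. [:-\<alpha>, 1:])"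
    unfolding H
    by (simp add: map_poly_hom_simps[OF homM] M(4) is_hom_minus[OF homM] is_homD[OF homM] del: mult_pCons_left)
  finally show ?case
    using N M by (intro exI[of _ "N * M"] conjI exI[of _ "ramify M \<alpha> # as"] exI[of _ U]) auto
qed

section \<open>Orders along the branches of a plane curve\<close>

definition fps_ord :: "complex fps \<Rightarrow> enat"
  where "fps_ord \<phi> = (if \<phi> = 0 then \<infinity> else enat (subdegree \<phi>))"

lemma fps_ord_mult: "fps_ord (\<phi> * \<psi>) = fps_ord \<phi> + fps_ord \<psi>"
  by (simp add: fps_ord_def)

lemma fps_ord_uminus: "fps_ord (- \<phi>) = fps_ord \<phi>"
  by (simp add: fps_ord_def)

lemma fps_ord_diff_commute: "fps_ord (\<phi> - \<psi>) = fps_ord (\<psi> - \<phi>)"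
  using fps_ord_uminus[of "\<phi> - \<psi>"] by simp

lemma fps_ord_unit: "fps_nth \<phi> 0 \<noteq> 0 \<Longrightarrow> fps_ord \<phi> = 0"
  by (auto simp: fps_ord_def zero_enat_def)

lemma fps_ord_X_power: "fps_ord (fps_X ^ n) = enat n"
  by (simp add: fps_ord_def)

lemma fps_ord_ge_iff: "enat n \<le> fps_ord \<phi> \<longleftrightarrow> (\<forall>k<n. fps_nth \<phi> k = 0)"
  by (auto simp: fps_ord_def intro: subdegree_geI nth_less_subdegree_zero)

lemma fps_ord_diff_ge:
  assumes "e \<le> fps_ord \<phi>" "e \<le> fps_ord \<psi>"
  shows "e \<le> fps_ord (\<phi> - \<psi>)"
proof (cases e)
  case (enat n)
  then show ?thesis using assms by (simp add: fps_ord_ge_iff)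
next
  case infinity
  then show ?thesis using assms by (auto simp: fps_ord_def split: if_splits)
qed

lemma fps_ord_ramify: "M > 0 \<Longrightarrow> fps_ord (ramify M \<phi>) = enat M * fps_ord \<phi>"
  by (auto simp: fps_ord_def ramify_def fps_compose_eq_0_iff zero_enat_def)

lemma fps_ord_prod_list: "fps_ord (prod_list \<phi>s) = sum_list (map fps_ord \<phi>s)"
proof (induction \<phi>s)
  case Nil
  show ?case by (simp add: fps_ord_unit)
qed (simp add: fps_ord_mult)

text \<open>Polynomials in two variables are elements of \<open>\<complex>[z][y]\<close>, and \<open>red\<close> sets \<open>z = 0\<close>.\<close>

type_synonym poly2 = "complex poly poly"

definition red :: "poly2 \<Rightarrow> complex poly"
  where "red = map_poly (\<lambda>c. poly c 0)"

definition emb :: "nat \<Rightarrow> complex poly \<Rightarrow> complex fps"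
  where "emb N = eval_hom fps_const (fps_X ^ N)"

text \<open>The pull-back of a polynomial along \<open>y = \<alpha>(t)\<close>, \<open>z = t\<^sup>N\<close>.\<close>

definition along :: "nat \<Rightarrow> complex fps \<Rightarrow> poly2 \<Rightarrow> complex fps"
  where "along N \<alpha> = eval_hom (emb N) \<alpha>"

text \<open>All roots y = \<alpha>(z^(1/N)) near the origin are listed, conjugates and repetitions
  included. Orders in t summed over the list are therefore N times an intersection multiplicity,
  without any splitting into irreducible components.\<close>

definition branches :: "nat \<Rightarrow> complex fps list \<Rightarrow> poly2 \<Rightarrow> bool"
  where "branches N as g \<longleftrightarrow> N > 0 \<and> (\<forall>\<alpha>\<in>set as. fps_nth \<alpha> 0 = 0) \<and>
    (\<exists>U. fps_nth (coeff U 0) 0 \<noteq> 0 \<and> map_poly (emb N) g = U * (\<Prod>\<alpha>\<leftarrow>as. [:-\<alpha>, 1:]))"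

lemma is_hom_fps_const: "is_hom (fps_const :: complex \<Rightarrow> complex fps)"
  by (simp add: is_hom_def)

lemma is_hom_emb: "is_hom (emb N)"
  unfolding emb_def by (intro is_hom_eval_hom is_hom_fps_const)

lemma is_hom_along: "is_hom (along N \<alpha>)"
  unfolding along_def by (intro is_hom_eval_hom is_hom_emb)

lemma is_hom_red: "is_hom red"
  unfolding red_def by (intro is_hom_map_poly is_hom_poly)

lemmas along_simps = is_homD[OF is_hom_along] is_hom_minus[OF is_hom_along]
lemmas red_simps = is_homD[OF is_hom_red] is_hom_minus[OF is_hom_red] is_hom_power[OF is_hom_red]

lemma emb_nth_0: "N > 0 \<Longrightarrow> fps_nth (emb N c) 0 = poly c 0"
  by (cases c) (simp add: emb_def eval_hom_pCons)

lemma ramify_emb: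
  assumes "N > 0" "M > 0"
  shows "ramify M (emb N c) = emb (N * M) c"
  unfolding emb_def hom_eval_hom[OF is_hom_ramify[OF \<open>M > 0\<close>] is_hom_fps_const]
  by (simp add: ramify_X_power \<open>M > 0\<close> mult.commute)

lemma emb_1: "emb 1 c = fps_of_poly c"
  by (induction c) (auto simp: emb_def eval_hom_pCons fps_of_poly_pCons fps_of_poly_0 mult.commute)

lemma ramify_along:
  assumes "N > 0" "M > 0"
  shows "along (N * M) (ramify M \<alpha>) h = ramify M (along N \<alpha> h)"
  unfolding along_def hom_eval_hom[OF is_hom_ramify[OF \<open>M > 0\<close>] is_hom_emb]
  by (simp add: ramify_emb assms)

lemma along_nth_0:
  assumes "N > 0" "fps_nth \<alpha> 0 = 0"
  shows "fps_nth (along N \<alpha> h) 0 = poly (red h) 0"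
proof -
  have "coeff (map_poly (emb N) h) 0 = emb N (coeff h 0)"
    by (simp add: coeff_map_poly is_homD[OF is_hom_emb])
  then show ?thesis
    using poly_nth_0[OF assms(2), of "map_poly (emb N) h"]
    by (simp add: along_def eval_hom_def emb_nth_0 assms red_def poly_0_coeff_0 coeff_map_poly)
qed

lemma along_z: "along N \<alpha> [:[:0, 1:]:] = fps_X ^ N"
  by (simp add: along_def emb_def eval_hom_pCons)

text \<open>Two curves get a common index in this way: each list is ramified by the index of the
  other.\<close>

lemma branches_ramify:
  assumes "branches N as g" "M > 0"
  shows "branches (N * M) (map (ramify M) as) g"
proof -
  obtain U where U: "N > 0" "\<forall>\<alpha>\<in>set as. fps_nth \<alpha> 0 = 0" "fps_nth (coeff U 0) 0 \<noteq> 0"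
    "map_poly (emb N) g = U * (\<Prod>\<alpha>\<leftarrow>as. [:-\<alpha>, 1:])"
    using assms by (auto simp: branches_def)
  have hom: "is_hom (ramify M)" using assms is_hom_ramify by blast
  have "map_poly (emb (N * M)) g = map_poly (ramify M) (map_poly (emb N) g)"
    using U(1) assms(2)
    by (intro poly_eqI) (simp add: coeff_map_poly ramify_emb is_homD[OF is_hom_ramify] is_homD[OF is_hom_emb])
  also have "map_poly (ramify M) (\<Prod>\<alpha>\<leftarrow>as. [:-\<alpha>, 1:]) = (\<Prod>\<alpha>\<leftarrow>map (ramify M) as. [:-\<alpha>, 1:])"
    by (induction as)
      (simp_all add: map_poly_hom_simps[OF hom] is_hom_minus[OF hom] is_homD[OF hom]
        map_poly_1' del: mult_pCons_left)
  then have "map_poly (ramify M) (map_poly (emb N) g)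
      = map_poly (ramify M) U * (\<Prod>\<alpha>\<leftarrow>map (ramify M) as. [:-\<alpha>, 1:])"
    by (simp add: U(4) map_poly_hom_simps[OF hom])
  finally show ?thesis
    unfolding branches_def using U assms(2)
    by (intro conjI exI[of _ "map_poly (ramify M) U"]) (auto simp: coeff_map_poly is_homD[OF hom])
qed

lemma poly_prod_list_linear: "poly (\<Prod>\<beta>\<leftarrow>bs. [:-\<beta>, 1:]) \<alpha> = (\<Prod>\<beta>\<leftarrow>bs. \<alpha> - \<beta>)"
  for \<alpha> :: "'a::comm_ring_1"
  by (induction bs) (auto simp: algebra_simps)

lemma branches_root:
  assumes "branches N as g" "\<alpha> \<in> set as"
  shows "along N \<alpha> g = 0"
proof -
  obtain U where "map_poly (emb N) g = U * (\<Prod>\<alpha>\<leftarrow>as. [:-\<alpha>, 1:])"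
    using assms by (auto simp: branches_def)
  then have "along N \<alpha> g = poly U \<alpha> * (\<Prod>\<beta>\<leftarrow>as. \<alpha> - \<beta>)"
    by (simp add: along_def eval_hom_def poly_prod_list_linear)
  moreover have "(\<Prod>\<beta>\<leftarrow>as. \<alpha> - \<beta>) = 0"
    using assms(2) by (auto simp: prod_list_zero_iff)
  ultimately show ?thesis by simp
qed

lemma ord_along:
  assumes "branches N bs h" "fps_nth \<alpha> 0 = 0"
  shows "fps_ord (along N \<alpha> h) = (\<Sum>\<beta>\<leftarrow>bs. fps_ord (\<alpha> - \<beta>))"
proof -
  obtain U where U: "fps_nth (coeff U 0) 0 \<noteq> 0" "map_poly (emb N) h = U * (\<Prod>\<alpha>\<leftarrow>bs. [:-\<alpha>, 1:])"
    using assms by (auto simp: branches_def)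
  then have "along N \<alpha> h = poly U \<alpha> * (\<Prod>\<beta>\<leftarrow>bs. \<alpha> - \<beta>)"
    by (simp add: along_def eval_hom_def poly_prod_list_linear)
  moreover have "fps_ord (poly U \<alpha>) = 0"
    using U(1) assms(2) by (simp add: fps_ord_unit poly_nth_0)
  ultimately show ?thesis
    by (simp add: fps_ord_mult fps_ord_prod_list o_def)
qed

lemma sum_list_swap:
  "(\<Sum>a\<leftarrow>as. \<Sum>b\<leftarrow>bs. f a b) = (\<Sum>b\<leftarrow>bs. \<Sum>a\<leftarrow>as. f a b :: 'a::comm_monoid_add)"
  by (induction as) (auto simp: sum_list_addf)

text \<open>Both sides are the sum of the orders of all differences \<alpha> - \<beta>, as in a
  resultant; the unit factors contribute 0.\<close>

lemma branches_symmetric: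
  assumes as: "branches N as g" and bs: "branches N bs h"
  shows "(\<Sum>\<alpha>\<leftarrow>as. fps_ord (along N \<alpha> h)) = (\<Sum>\<beta>\<leftarrow>bs. fps_ord (along N \<beta> g))"
proof -
  have *: "\<forall>\<alpha>\<in>set as. fps_nth \<alpha> 0 = 0" "\<forall>\<beta>\<in>set bs. fps_nth \<beta> 0 = 0"
    using assms by (auto simp: branches_def)
  have "(\<Sum>\<alpha>\<leftarrow>as. fps_ord (along N \<alpha> h)) = (\<Sum>\<alpha>\<leftarrow>as. \<Sum>\<beta>\<leftarrow>bs. fps_ord (\<beta> - \<alpha>))"
    using * by (intro arg_cong[of _ _ sum_list] map_cong refl) (simp add: ord_along[OF bs] fps_ord_diff_commute)
  also have "\<dots> = (\<Sum>\<beta>\<leftarrow>bs. \<Sum>\<alpha>\<leftarrow>as. fps_ord (\<beta> - \<alpha>))"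
    by (rule sum_list_swap)
  also have "\<dots> = (\<Sum>\<beta>\<leftarrow>bs. fps_ord (along N \<beta> g))"
    using * by (intro arg_cong[of _ _ sum_list] map_cong refl) (simp add: ord_along[OF as])
  finally show ?thesis .
qed

lemma red_eq_X_power_mult:
  assumes "red g \<noteq> 0"
  obtains u where "red g = [:0, 1:] ^ order 0 (red g) * u" "poly u 0 \<noteq> 0"
  using order_decomp[OF assms, of 0] by (auto simp: poly_eq_0_iff_dvd)

text \<open>As g(y, 0) is nonzero, it has a finite order at 0, and this is the order r that
  \<open>puiseux_factorization\<close> asks for.\<close>

lemma branches_exist:
  assumes "red g \<noteq> 0"
  shows "\<exists>N as. branches N as g"
proof -
  obtain u where u: "red g = [:0, 1:] ^ order 0 (red g) * u" "poly u 0 \<noteq> 0"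
    using red_eq_X_power_mult[OF assms] .
  define r where "r = order 0 (red g)"
  define G where "G = map_poly fps_of_poly g"
  have "fps_nth (coeff G k) 0 = coeff ([:0, 1:] ^ r * u) k" for k
    unfolding r_def u(1) [symmetric]
    by (simp add: G_def red_def coeff_map_poly poly_0_coeff_0)
  then have "fps_nth (coeff G k) 0 = (if k < r then 0 else coeff u (k - r))" for k
    by (simp only: coeff_X_power_mult)
  with u(2) obtain N as U where N: "N > 0" "\<forall>\<alpha>\<in>set as. fps_nth \<alpha> 0 = 0" "fps_nth (coeff U 0) 0 \<noteq> 0"
    "map_poly (ramify N) G = U * (\<Prod>\<alpha>\<leftarrow>as. [:-\<alpha>, 1:])"
    using puiseux_factorization[of r G] by (auto simp: poly_0_coeff_0)
  have "map_poly (ramify N) G = map_poly (emb N) g"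
    using ramify_emb[of 1 N] N(1)
    by (intro poly_eqI) (simp add: G_def coeff_map_poly is_homD[OF is_hom_ramify] is_homD[OF is_hom_emb] flip: emb_1)
  then have "branches N as g" using N unfolding branches_def by metis
  then show ?thesis by blast
qed

text \<open>At t = 0 the factorization becomes a power of y times a polynomial that does not vanish
  at 0.\<close>

lemma branches_length:
  assumes "branches N as g"
  shows "red g \<noteq> 0" "length as = order 0 (red g)"
proof -
  obtain U where U: "N > 0" "\<forall>\<alpha>\<in>set as. fps_nth \<alpha> 0 = 0" "fps_nth (coeff U 0) 0 \<noteq> 0"
    "map_poly (emb N) g = U * (\<Prod>\<alpha>\<leftarrow>as. [:-\<alpha>, 1:])"
    using assms by (auto simp: branches_def)
  have "red g = red0 (map_poly (emb N) g)"
    using U(1)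
    by (intro poly_eqI) (simp add: red_def coeff_map_poly emb_nth_0 is_homD[OF is_hom_emb])
  also have "\<dots> = red0 U * red0 (\<Prod>\<alpha>\<leftarrow>as. [:-\<alpha>, 1:])"
    by (simp add: U(4) map_poly_hom_simps[OF is_hom_fps_nth_0])
  also have "red0 (\<Prod>\<alpha>\<leftarrow>as. [:-\<alpha>, 1:]) = [:0, 1:] ^ length as"
    using U(2)
    by (induction as)
      (simp_all add: map_poly_hom_simps[OF is_hom_fps_nth_0] map_poly_1' del: mult_pCons_left)
  finally have red: "red g = [:0, 1:] ^ length as * red0 U" by (simp only: mult.commute)
  have nz: "poly (red0 U) 0 \<noteq> 0"
    using U(3) by (simp add: poly_0_coeff_0 coeff_map_poly)
  show "red g \<noteq> 0"
    unfolding red using nz by auto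
  have "order 0 ([:0, 1:] ^ length as * red0 U) = order 0 ([:-0, 1:] ^ length as :: complex poly) + order 0 (red0 U)"
    using \<open>red g \<noteq> 0\<close> unfolding red by (subst order_mult) auto
  also have "\<dots> = length as"
    using nz order_root[of "red0 U" 0] by (simp only: order_power_n_n) auto
  finally show "length as = order 0 (red g)" by (simp only: red)
qed

section \<open>Intersection multiplicities in the affine plane\<close>

text \<open>The contraction to \<open>\<complex>[z][y]\<close> of the ideal generated by \<open>g\<close> and \<open>h\<close> in the local ring
  at the origin.\<close>

definition loc_ideal :: "poly2 \<Rightarrow> poly2 \<Rightarrow> poly2 set"
  where "loc_ideal g h = {a. \<exists>u s t. poly (red u) 0 \<noteq> 0 \<and> u * a = s * g + t * h}"

text \<open>Families rather than the sets of \<open>quotient_dim\<close>: elimination and division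
  replace the members index by index, and \<open>indep_mod_inj_on\<close> recovers sets at the
  end.\<close>

definition indep_mod :: "poly2 set \<Rightarrow> nat \<Rightarrow> (nat \<Rightarrow> poly2) \<Rightarrow> bool"
  where "indep_mod W n b \<longleftrightarrow> (\<forall>c. (\<Sum>i<n. smult [:c i:] (b i)) \<in> W \<longrightarrow> (\<forall>i<n. c i = 0))"

definition loc_mult :: "poly2 \<Rightarrow> poly2 \<Rightarrow> enat"
  where "loc_mult g h = (SUP n \<in> {n. \<exists>b. indep_mod (loc_ideal g h) n b}. enat n)"

lemma loc_mult_geI: "indep_mod (loc_ideal g h) n b \<Longrightarrow> enat n \<le> loc_mult g h"
  unfolding loc_mult_def by (rule SUP_upper) auto

lemma loc_mult_leI: "(\<And>n b. indep_mod (loc_ideal g h) n b \<Longrightarrow> enat n \<le> m) \<Longrightarrow> loc_mult g h \<le> m"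
  unfolding loc_mult_def by (rule SUP_least) auto

lemma loc_idealI: "u * a = s * g + t * h \<Longrightarrow> poly (red u) 0 \<noteq> 0 \<Longrightarrow> a \<in> loc_ideal g h"
  by (auto simp: loc_ideal_def)

lemma loc_idealE:
  assumes "a \<in> loc_ideal g h"
  obtains u s t where "poly (red u) 0 \<noteq> 0" "u * a = s * g + t * h"
  using assms by (auto simp: loc_ideal_def)

lemma loc_ideal_subset:
  assumes "g \<in> loc_ideal g' h'" "h \<in> loc_ideal g' h'"
  shows "loc_ideal g h \<subseteq> loc_ideal g' h'"
proof
  fix a assume "a \<in> loc_ideal g h"
  then obtain u s t where u: "poly (red u) 0 \<noteq> 0" "u * a = s * g + t * h" by (rule loc_idealE)
  obtain u1 s1 t1 where 1: "poly (red u1) 0 \<noteq> 0" "u1 * g = s1 * g' + t1 * h'"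
    using assms(1) by (rule loc_idealE)
  obtain u2 s2 t2 where 2: "poly (red u2) 0 \<noteq> 0" "u2 * h = s2 * g' + t2 * h'"
    using assms(2) by (rule loc_idealE)
  have "(u1 * u2 * u) * a = u1 * u2 * (s * g + t * h)"
    by (simp only: u mult.assoc)
  also have "\<dots> = s * u2 * (u1 * g) + t * u1 * (u2 * h)"
    by (simp only: algebra_simps)
  also have "\<dots> = (s * u2 * s1 + t * u1 * s2) * g' + (s * u2 * t1 + t * u1 * t2) * h'"
    unfolding 1 2 by (simp only: algebra_simps)
  finally show "a \<in> loc_ideal g' h'"
    by (rule loc_idealI) (use u 1 2 in \<open>simp add: red_simps\<close>)
qed

lemma loc_ideal_generators: "g \<in> loc_ideal g h" "h \<in> loc_ideal g h"
proof -
  show "g \<in> loc_ideal g h" by (rule loc_idealI[of 1 _ 1 _ 0]) (simp_all add: red_simps)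
  show "h \<in> loc_ideal g h" by (rule loc_idealI[of 1 _ 0 _ 1]) (simp_all add: red_simps)
qed

lemma loc_mult_cong:
  assumes "g \<in> loc_ideal g' h'" "h \<in> loc_ideal g' h'" "g' \<in> loc_ideal g h" "h' \<in> loc_ideal g h"
  shows "loc_mult g h = loc_mult g' h'"
proof -
  have "loc_ideal g h = loc_ideal g' h'"
    using assms by (intro equalityI loc_ideal_subset)
  then show ?thesis by (simp add: loc_mult_def)
qed

lemma loc_mult_commute: "loc_mult g h = loc_mult h g"
  by (intro loc_mult_cong loc_ideal_generators)

lemma loc_mult_unit:
  assumes "poly (red g) 0 \<noteq> 0"
  shows "loc_mult g h = 0"
proof -
  have *: "a \<in> loc_ideal g h" for a
    by (rule loc_idealI[of g _ a _ 0]) (use assms in \<open>simp_all add: mult.commute\<close>)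
  have "n = 0" if "indep_mod (loc_ideal g h) n b" for n b
  proof (rule ccontr)
    assume "n \<noteq> 0"
    then have "(1::complex) = 0"
      using that * unfolding indep_mod_def by (elim allE[of _ "\<lambda>_. 1"]) auto
    then show False by simp
  qed
  then have "loc_mult g h \<le> 0"
    by (intro loc_mult_leI) (metis order_refl zero_enat_def)
  then show ?thesis by simp
qed

section \<open>Restriction to the line z = 0 and splitting off a factor z\<close>

abbreviation lift_y :: "complex poly \<Rightarrow> poly2"
  where "lift_y \<equiv> map_poly (\<lambda>c. [:c:])"

abbreviation var_z :: poly2
  where "var_z \<equiv> [:[:0, 1:]:]"

lemma is_hom_const_poly: "is_hom (\<lambda>c :: 'a::comm_ring_1. [:c:])"
  by (simp add: is_hom_def one_pCons)

lemma red_lift_y [simp]: "red (lift_y p) = p"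
  by (intro poly_eqI) (simp add: red_def coeff_map_poly)

lemma red_var_z [simp]: "red var_z = 0" "red (var_z * g) = 0"
proof -
  show *: "red var_z = 0" by (simp add: red_def map_poly_pCons)
  show "red (var_z * g) = 0" by (simp only: red_simps * mult_zero_left)
qed

lemma red_eq_0_iff: "red g = 0 \<longleftrightarrow> (\<exists>g'. g = var_z * g')"
proof
  assume "red g = 0"
  then have *: "poly (coeff g k) 0 = 0" for k
    by (metis coeff_0 coeff_map_poly poly_0 red_def)
  have "\<forall>k. \<exists>c. coeff g k = [:0, 1:] * c"
  proof
    fix k show "\<exists>c. coeff g k = [:0, 1:] * c"
      using *[of k] by (cases "coeff g k") auto
  qed
  then obtain c where c: "\<And>k. coeff g k = [:0, 1:] * c k" by metis
  define g' where "g' = (\<Sum>k\<le>degree g. monom (c k) k)"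
  have "coeff g' k = c k" if "k \<le> degree g" for k
    using that by (simp add: g'_def coeff_sum)
  moreover have "coeff g' k = 0" "coeff g k = 0" if "\<not> k \<le> degree g" for k
    using that by (auto simp: g'_def coeff_sum coeff_eq_0)
  ultimately have "coeff g k = [:0, 1:] * coeff g' k" for k
    using c[of k] by (cases "k \<le> degree g") auto
  then have "g = var_z * g'"
    by (intro poly_eqI) simp
  then show "\<exists>g'. g = var_z * g'" ..
qed (metis red_var_z(2))

lemma red_smult_const: "red (smult [:c:] a) = smult c (red a)"
  by (intro poly_eqI) (simp add: red_def coeff_map_poly)

text \<open>Gaussian elimination: a linear functional costs at most one dimension.\<close>

lemma indep_mod_eliminate:
  assumes "indep_mod W n b"
  shows "\<exists>b'. indep_mod W (n - r) b' \<and> (\<forall>i<n - r. \<forall>k<r. coeff (red (b' i)) k = 0)"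
proof (induction r)
  case 0
  show ?case using assms by auto
next
  case (Suc r)
  then obtain b where b: "indep_mod W (n - r) b" "\<And>i k. i < n - r \<Longrightarrow> k < r \<Longrightarrow> coeff (red (b i)) k = 0"
    by blast
  show ?case
  proof (cases "\<forall>i<n - r. coeff (red (b i)) r = 0")
    case True
    have "indep_mod W (n - Suc r) b"
      unfolding indep_mod_def
    proof (intro allI impI)
      fix c i assume c: "(\<Sum>i<n - Suc r. smult [:c i:] (b i)) \<in> W" and i: "i < n - Suc r"
      define c' where "c' j = (if j < n - Suc r then c j else 0)" for j
      have "(\<Sum>j<n - r. smult [:c' j:] (b j)) = (\<Sum>j<n - Suc r. smult [:c j:] (b j))"
        by (intro sum.mono_neutral_cong_right) (auto simp: c'_def)
      with b(1) c have "\<forall>j<n - r. c' j = 0" unfolding indep_mod_def by simp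
      then have "c' i = 0" using i by simp
      then show "c i = 0" using i by (simp add: c'_def)
    qed
    moreover have "coeff (red (b i)) k = 0" if "i < n - Suc r" "k < Suc r" for i k
      using that True b(2) by (cases "k = r") auto
    ultimately show ?thesis by blast
  next
    case False
    then obtain j where j: "j < n - r" "coeff (red (b j)) r \<noteq> 0" by blast
    define m where "m = n - Suc r"
    have m: "n - r = Suc m" using j by (simp add: m_def)
    \<comment> \<open>The pivot \<open>b j\<close> clears coefficient r of the other members and is
      then dropped; \<sigma> enumerates the remaining indices.\<close>
    define \<sigma> where "\<sigma> i = (if i < j then i else Suc i)" for i
    have \<sigma>: "bij_betw \<sigma> {..<m} ({..<Suc m} - {j})"
      using j m unfolding bij_betw_def
    proof (intro conjI)
      show "inj_on \<sigma> {..<m}" by (auto simp: inj_on_def \<sigma>_def split: if_splits)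
      show "\<sigma> ` {..<m} = {..<Suc m} - {j}"
      proof (intro equalityI subsetI)
        fix x assume x: "x \<in> {..<Suc m} - {j}"
        show "x \<in> \<sigma> ` {..<m}"
          using x j m by (intro image_eqI[of _ _ "if x < j then x else x - 1"]) (auto simp: \<sigma>_def)
      qed (use j m in \<open>auto simp: \<sigma>_def split: if_splits\<close>)
    qed
    define lam where "lam i = coeff (red (b i)) r / coeff (red (b j)) r" for i
    define b' where "b' i = b (\<sigma> i) - smult [:lam (\<sigma> i):] (b j)" for i
    have \<sigma>_less: "\<sigma> i < n - r" if "i < m" for i
      using \<sigma> that m unfolding bij_betw_def by auto
    have "coeff (red (b' i)) k = 0" if "i < m" "k < Suc r" for i k
    proof -
      have "coeff (red (b' i)) k = coeff (red (b (\<sigma> i))) k - lam (\<sigma> i) * coeff (red (b j)) k"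
        by (simp add: b'_def red_simps red_smult_const)
      then show ?thesis
        using that b(2)[of j k] b(2)[of "\<sigma> i" k] \<sigma>_less[of i] j by (cases "k = r") (auto simp: lam_def)
    qed
    moreover have "indep_mod W m b'"
      unfolding indep_mod_def
    proof (intro allI impI)
      fix c i assume c: "(\<Sum>i<m. smult [:c i:] (b' i)) \<in> W" and i: "i < m"
      define \<tau> where "\<tau> = inv_into {..<m} \<sigma>"
      \<comment> \<open>A relation among the \<open>b'\<close> becomes one among the
        \<open>b\<close>, in which the pivot collects all the subtracted multiples.\<close>
      define d where "d l = (if l = j then - (\<Sum>i<m. c i * lam (\<sigma> i)) else c (\<tau> l))" for l
      have d: "d (\<sigma> i) = c i" if "i < m" for i
      proof -
        have "\<sigma> i \<noteq> j" by (auto simp: \<sigma>_def)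
        moreover have "\<tau> (\<sigma> i) = i"
          unfolding \<tau>_def using that \<sigma> by (intro inv_into_f_f) (auto simp: bij_betw_def)
        ultimately show ?thesis by (simp add: d_def)
      qed
      have "(\<Sum>l<n - r. smult [:d l:] (b l)) = smult [:d j:] (b j) + (\<Sum>l\<in>{..<Suc m} - {j}. smult [:d l:] (b l))"
        unfolding m using j m by (intro sum.remove) auto
      also have "(\<Sum>l\<in>{..<Suc m} - {j}. smult [:d l:] (b l)) = (\<Sum>i<m. smult [:d (\<sigma> i):] (b (\<sigma> i)))"
        by (rule sum.reindex_bij_betw[OF \<sigma>, symmetric])
      also have "\<dots> = (\<Sum>i<m. smult [:c i:] (b (\<sigma> i)))"
        by (intro sum.cong) (auto simp: d)
      also have "smult [:d j:] (b j) = (\<Sum>i<m. - smult [:c i:] (smult [:lam (\<sigma> i):] (b j)))"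
      proof -
        have "[:d j:] = (\<Sum>i<m. - [:c i * lam (\<sigma> i):])"
          by (intro poly_eqI) (simp add: d_def coeff_sum coeff_pCons sum_negf split: nat.splits)
        then show ?thesis by (simp add: smult_sum mult.commute flip: smult_minus_left)
      qed
      also have "\<dots> + (\<Sum>i<m. smult [:c i:] (b (\<sigma> i))) = (\<Sum>i<m. smult [:c i:] (b' i))"
        unfolding sum.distrib [symmetric] b'_def by (intro sum.cong refl) (simp add: smult_diff_right)
      finally have "(\<Sum>l<n - r. smult [:d l:] (b l)) \<in> W" using c by simp
      then have "d (\<sigma> i) = 0" using b(1) \<sigma>_less[OF i] unfolding indep_mod_def by blast
      then show "c i = 0" using d i by simp
    qed
    ultimately show ?thesis unfolding m_def by blast
  qed
qed

text \<open>The factor \<open>w\<close> does not vanish at 0, so the powers of the variable can be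
  split off \<open>p\<close> one at a time.\<close>

lemma X_power_dvd_unit_mult:
  fixes w p v :: "complex poly"
  assumes "w * p = [:0, 1:] ^ r * v" "poly w 0 \<noteq> 0"
  shows "[:0, 1:] ^ r dvd p"
  using assms(1)
proof (induction r arbitrary: v)
  case (Suc r)
  then obtain q where q: "p = [:0, 1:] ^ r * q"
    by (metis dvdE power_Suc2 mult.assoc)
  have "[:0, 1:] ^ r * (w * q) = [:0, 1:] ^ r * ([:0, 1:] * v)"
    using Suc.prems q by (simp only: power_Suc mult_ac)
  then have "w * q = [:0, 1:] * v" by (subst (asm) mult_left_cancel) auto
  then have "poly (w * q) 0 = 0" by simp
  then have "[:0, 1:] dvd q" using assms(2) poly_eq_0_iff_dvd[of q 0] by simp
  then show ?case unfolding q power_Suc2 by (rule mult_dvd_mono[OF dvd_refl])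
qed simp

text \<open>On z = 0 both polynomials are multiples of y^r, say with cofactors u and v, so u h - v g
  vanishes there and z divides it. Where this is used u is a unit at the origin, and multiplying by
  it stands in for a division.\<close>

lemma division_step:
  assumes "red g = [:0, 1:] ^ r * u" "[:0, 1:] ^ r dvd red h"
  shows "\<exists>a h'. lift_y u * h = a * g + var_z * h'"
proof -
  obtain v where v: "red h = [:0, 1:] ^ r * v"
    using assms(2) by (rule dvdE)
  have "red (lift_y u * h - lift_y v * g) = 0"
    by (simp add: red_simps v assms(1))
  then obtain c where "lift_y u * h - lift_y v * g = var_z * c"
    unfolding red_eq_0_iff by blast
  then have "lift_y u * h = lift_y v * g + var_z * c"
    by (simp only: diff_eq_eq add.commute)
  then show ?thesis by blast
qed

text \<open>Additivity, with r = i(g, z). The powers of y below r form a basis modulo g and z, and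
  multiplication by z embeds the quotient by (g, h) into the quotient by (g, z h), because z is not
  a zero divisor modulo g.\<close>

lemma loc_mult_var_z:
  assumes g: "red g = [:0, 1:] ^ r * u" "poly u 0 \<noteq> 0"
  shows "loc_mult g (var_z * h) = enat r + loc_mult g h"
proof (rule antisym)
  have "u \<noteq> 0" using g by auto
  show "loc_mult g (var_z * h) \<le> enat r + loc_mult g h"
  proof (rule loc_mult_leI)
    fix n b assume "indep_mod (loc_ideal g (var_z * h)) n b"
    \<comment> \<open>Giving up r members makes the others divisible by y^r on z = 0. Up to a unit
      and modulo g they are then z times some \<open>c i\<close>.\<close>
    then obtain b' where b': "indep_mod (loc_ideal g (var_z * h)) (n - r) b'"
      "\<And>i k. i < n - r \<Longrightarrow> k < r \<Longrightarrow> coeff (red (b' i)) k = 0"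
      using indep_mod_eliminate by blast
    have "\<exists>a c. lift_y u * b' i = a * g + var_z * c" if "i < n - r" for i
    proof (rule division_step[OF g(1)])
      have "monom 1 r dvd red (b' i)"
        using b'(2)[OF that] by (simp add: monom_1_dvd_iff')
      then show "[:0, 1:] ^ r dvd red (b' i)"
        by (simp add: monom_altdef)
    qed
    then obtain a c where ac: "\<And>i. i < n - r \<Longrightarrow> lift_y u * b' i = a i * g + var_z * c i"
      by metis
    have "indep_mod (loc_ideal g h) (n - r) c"
      unfolding indep_mod_def
    proof (intro allI impI)
      fix l i assume l: "(\<Sum>i<n - r. smult [:l i:] (c i)) \<in> loc_ideal g h" and i: "i < n - r"
      let ?C = "\<Sum>i<n - r. smult [:l i:] (c i)"
      let ?A = "\<Sum>i<n - r. smult [:l i:] (a i)"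
      let ?B = "\<Sum>i<n - r. smult [:l i:] (b' i)"
      obtain w s t where w: "poly (red w) 0 \<noteq> 0" "w * ?C = s * g + t * h"
        using l by (rule loc_idealE)
      have "lift_y u * ?B = (\<Sum>i<n - r. smult [:l i:] (a i * g + var_z * c i))"
        by (simp add: sum_distrib_left ac del: mult_pCons_left)
      also have "\<dots> = ?A * g + var_z * ?C"
        by (simp only: sum_distrib_left sum_distrib_right sum.distrib smult_add_right
            mult_smult_left mult_smult_right)
      finally have B: "lift_y u * ?B = ?A * g + var_z * ?C" .
      have "(w * lift_y u) * ?B = w * ?A * g + var_z * (w * ?C)"
        by (simp only: mult.assoc B) (simp only: algebra_simps)
      also have "\<dots> = (w * ?A + var_z * s) * g + t * (var_z * h)"
        unfolding w(2) by (simp only: algebra_simps)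
      finally have "?B \<in> loc_ideal g (var_z * h)"
        by (rule loc_idealI) (use w g in \<open>simp add: red_simps\<close>)
      then show "l i = 0" using b'(1) i unfolding indep_mod_def by blast
    qed
    then have "enat (n - r) \<le> loc_mult g h" by (rule loc_mult_geI)
    moreover have "enat n \<le> enat r + enat (n - r)" by simp
    ultimately show "enat n \<le> enat r + loc_mult g h"
      by (metis add_left_mono order_trans)
  qed
  show "enat r + loc_mult g h \<le> loc_mult g (var_z * h)"
  proof -
    have "enat (r + n) \<le> loc_mult g (var_z * h)" if b: "indep_mod (loc_ideal g h) n b" for n b
    proof (rule loc_mult_geI[where b = "\<lambda>i. if i < r then monom 1 i else var_z * b (i - r)"])
      show "indep_mod (loc_ideal g (var_z * h)) (r + n) (\<lambda>i. if i < r then monom 1 i else var_z * b (i - r))"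
        (is "indep_mod _ _ ?b") unfolding indep_mod_def
      proof (rule allI, rule impI)
        fix c assume "(\<Sum>i<r + n. smult [:c i:] (?b i)) \<in> loc_ideal g (var_z * h)"
        also have "(\<Sum>i<r + n. smult [:c i:] (?b i))
          = (\<Sum>i<r. smult [:c i:] (?b i)) + (\<Sum>i<n. smult [:c (r + i):] (?b (r + i)))"
          by (simp only: lessThan_atLeast0 sum.atLeastLessThan_concat[of 0 r "r + n", symmetric, simplified])
            (simp add: sum.shift_bounds_nat_ivl[of _ 0 r n, simplified] add.commute)
        also have "(\<Sum>i<r. smult [:c i:] (?b i)) = (\<Sum>i<r. monom [:c i:] i)"
          by (intro sum.cong) (auto simp: smult_monom)
        also have "(\<Sum>i<n. smult [:c (r + i):] (?b (r + i))) = var_z * (\<Sum>i<n. smult [:c (r + i):] (b i))"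
          unfolding sum_distrib_left by (intro sum.cong) (auto simp: mult_smult_right simp del: mult_pCons_left)
        finally obtain w s t where w: "poly (red w) 0 \<noteq> 0" and
          eq: "w * ((\<Sum>i<r. monom [:c i:] i) + var_z * (\<Sum>i<n. smult [:c (r + i):] (b i))) = s * g + t * (var_z * h)"
          by (rule loc_idealE)
        define P where "P = (\<Sum>i<r. monom (c i) i)"
        let ?Q = "\<Sum>i<n. smult [:c (r + i):] (b i)"
        have P: "(\<Sum>i<r. monom [:c i:] i) = lift_y P"
          by (intro poly_eqI) (simp add: P_def coeff_map_poly coeff_sum if_distrib cong: if_cong)
        have zero: "red (t * (var_z * h)) = 0" "red (var_z * ?Q) = 0"
          by (simp_all only: red_var_z red_simps mult_zero_right mult_zero_left)
        \<comment> \<open>Setting z = 0 makes y^r divide w P. Since \<open>w\<close> is a unit at 0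
          and \<open>P\<close> has only terms below y^r, \<open>P\<close> is 0.\<close>
        have "red w * P = [:0, 1:] ^ r * (red s * u)"
          using arg_cong[OF eq, of red] unfolding P
          by (simp only: red_simps red_lift_y red_var_z zero g) (simp add: mult_ac)
        then have "monom 1 r dvd P"
          using X_power_dvd_unit_mult w by (simp add: monom_altdef)
        then have cP: "coeff P k = 0" if "k < r" for k
          using that by (simp add: monom_1_dvd_iff')
        have c0: "c k = 0" if "k < r" for k
          using cP[OF that] that by (simp add: P_def coeff_sum)
        then have "P = 0" by (simp add: P_def)
        then have "red s = 0"
          using \<open>red w * P = _\<close> \<open>u \<noteq> 0\<close> by simp
        \<comment> \<open>Hence z divides \<open>s\<close>, and the factor z cancels from the whole
          relation.\<close>
        then obtain s' where s': "s = var_z * s'" unfolding red_eq_0_iff by blast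
        have "var_z * (w * ?Q) = var_z * (s' * g + t * h)"
          using eq unfolding P \<open>P = 0\<close> s' by (simp only: map_poly_0 add_0_left algebra_simps)
        then have "w * ?Q = s' * g + t * h"
          by (subst (asm) mult_left_cancel) auto
        then have "?Q \<in> loc_ideal g h" using w by (rule loc_idealI)
        then have "\<forall>i<n. c (r + i) = 0"
          using b unfolding indep_mod_def by (elim allE[of _ "\<lambda>i. c (r + i)"]) simp
        then show "\<forall>i<r + n. c i = 0"
          using c0 by (metis add_diff_inverse_nat nat_add_left_cancel_less not_less)
      qed
    qed
    then have *: "enat r + enat n \<le> loc_mult g (var_z * h)" if "indep_mod (loc_ideal g h) n b" for n b
      using that by simp
    show ?thesis
    proof (cases "loc_mult g (var_z * h)")
      case (enat N)
      have "loc_mult g h \<le> enat (N - r)"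
        by (rule loc_mult_leI) (use * enat in fastforce)
      moreover have "r \<le> N"
        using *[of 0 "\<lambda>_. 0"] enat by (simp add: indep_mod_def)
      ultimately show ?thesis
        unfolding enat by (cases "loc_mult g h") auto
    qed simp
  qed
qed

lemma loc_mult_eq_mult_var_z:
  assumes "lift_y u * h = a * g + var_z * h'" "poly u 0 \<noteq> 0"
  shows "loc_mult g h = loc_mult g (var_z * h')"
proof (rule loc_mult_cong)
  show "h \<in> loc_ideal g (var_z * h')"
    using assms by (intro loc_idealI[of "lift_y u" h a g 1]) simp_all
  have "1 * (var_z * h') = - a * g + lift_y u * h"
    by (simp only: assms(1)) simp
  then show "var_z * h' \<in> loc_ideal g h"
    by (rule loc_idealI) (simp add: red_simps)
qed (auto intro: loc_ideal_generators)

section \<open>Intersection multiplicity as a sum of orders along branches\<close>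

lemma enat_min_shift:
  fixes a b c c' e :: enat
  assumes "min a c = min b c" "c' \<le> e + c"
  shows "min (e + a) c' = min (e + b) c'"
proof -
  have "min (e + a) c' = min (e + min a c) c'" for a
    using assms(2) by (cases a; cases c; cases c'; cases e) (auto simp: min_def)
  then show ?thesis using assms(1) by metis
qed

lemma enat_mult_le_cancel: "M > 0 \<Longrightarrow> enat M * a \<le> enat M * b \<longleftrightarrow> a \<le> b"
  by (cases a; cases b) (auto simp: zero_enat_def)

lemma enat_mult_cancel: "M > 0 \<Longrightarrow> enat M * a = enat M * b \<longleftrightarrow> a = b"
  by (metis enat_mult_le_cancel order_antisym order_refl)

lemma enat_mult_min: "M > 0 \<Longrightarrow> enat M * min a b = min (enat M * a) (enat M * b)"
  by (simp add: min_def enat_mult_le_cancel)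

definition branch_sum :: "nat \<Rightarrow> complex fps list \<Rightarrow> poly2 \<Rightarrow> enat"
  where "branch_sum N as h = (\<Sum>\<alpha>\<leftarrow>as. fps_ord (along N \<alpha> h))"

lemma branch_sum_mult: "branch_sum N as (g * h) = branch_sum N as g + branch_sum N as h"
  by (simp add: branch_sum_def along_simps fps_ord_mult sum_list_addf)

lemma branch_sum_var_z: "branch_sum N as var_z = enat N * enat (length as)"
  by (simp add: branch_sum_def along_z fps_ord_X_power sum_list_triv of_nat_eq_enat mult.commute)

lemma branch_sum_unit:
  assumes "branches N as g" "poly (red h) 0 \<noteq> 0"
  shows "branch_sum N as h = 0"
proof -
  have "fps_ord (along N \<alpha> h) = 0" if "\<alpha> \<in> set as" for \<alpha>
    using that assms along_nth_0[of N \<alpha> h] by (auto simp: branches_def fps_ord_unit)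
  then have "branch_sum N as h = (\<Sum>\<alpha>\<leftarrow>as. 0)"
    unfolding branch_sum_def by (intro arg_cong[of _ _ sum_list] map_cong) auto
  then show ?thesis by simp
qed

lemma branch_sum_ramify:
  assumes "branches N as g" "M > 0"
  shows "branch_sum (N * M) (map (ramify M) as) h = enat M * branch_sum N as h"
proof -
  have "N > 0" using assms by (simp add: branches_def)
  have "(\<Sum>\<alpha>\<leftarrow>as. enat M * fps_ord (along N \<alpha> h)) = enat M * (\<Sum>\<alpha>\<leftarrow>as. fps_ord (along N \<alpha> h))"
    by (rule sum_list_const_mult)
  then show ?thesis
    by (simp add: branch_sum_def o_def ramify_along fps_ord_ramify assms \<open>N > 0\<close>)
qed

text \<open>A division step replaces h by z h' modulo g. Along the branches this changes no order,
  as g vanishes there and u is a unit; removing z then takes N r off both sides. Since r > 0,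
  agreement for h' up to N k gives agreement for h up to N (k + 1).\<close>

lemma branch_sum_step:
  assumes br: "branches N as g" and dvd: "[:0, 1:] ^ length as dvd red h" and "as \<noteq> []"
    and IH: "\<And>h'. min (branch_sum N as h') (enat (N * k)) = min (enat N * loc_mult g h') (enat (N * k))"
  shows "min (branch_sum N as h) (enat (N * Suc k)) = min (enat N * loc_mult g h) (enat (N * Suc k))"
proof -
  define r where "r = length as"
  have "r > 0" using assms by (simp add: r_def)
  obtain u where u: "red g = [:0, 1:] ^ r * u" "poly u 0 \<noteq> 0"
    using red_eq_X_power_mult[of g] branches_length[OF br] by (auto simp: r_def)
  obtain a h' where h': "lift_y u * h = a * g + var_z * h'"
    using division_step[OF u(1)] dvd unfolding r_def by blast
  have "loc_mult g h = enat r + loc_mult g h'"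
    using loc_mult_eq_mult_var_z[OF h' u(2)] loc_mult_var_z[OF u] by simp
  then have m: "enat N * loc_mult g h = enat (N * r) + enat N * loc_mult g h'"
    by (simp add: distrib_left)
  have "fps_ord (along N \<alpha> h) = fps_ord (along N \<alpha> (var_z * h'))" if "\<alpha> \<in> set as" for \<alpha>
  proof -
    have "fps_ord (along N \<alpha> (lift_y u)) = 0"
      using that br u(2) along_nth_0[of N \<alpha> "lift_y u"] by (auto simp: branches_def fps_ord_unit)
    then have "fps_ord (along N \<alpha> h) = fps_ord (along N \<alpha> (lift_y u * h))"
      by (simp add: along_simps fps_ord_mult)
    then show ?thesis
      using branches_root[OF br that] unfolding h' by (simp add: along_simps)
  qed
  then have "branch_sum N as h = branch_sum N as (var_z * h')"
    unfolding branch_sum_def by (intro arg_cong[of _ _ sum_list] map_cong) auto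
  then have s: "branch_sum N as h = enat (N * r) + branch_sum N as h'"
    by (simp only: branch_sum_mult branch_sum_var_z) (simp add: r_def)
  have "N * Suc k \<le> N * (r + k)" using \<open>r > 0\<close> by (intro mult_le_mono2) simp
  then have "enat (N * Suc k) \<le> enat (N * r) + enat (N * k)"
    by (simp add: distrib_left)
  then show ?thesis
    unfolding m s using IH by (intro enat_min_shift)
qed

text \<open>Fulton's reduction: a common factor \<open>z\<close> is split off after one division step, and if \<open>h\<close> has
  the smaller order on \<open>z = 0\<close>, the two curves are exchanged first. The truncation allows one
  induction to cover the case of infinite multiplicity as well.\<close>

lemma branch_sum_truncated:
  assumes "branches N as g"
  shows "min (branch_sum N as h) (enat (N * k)) = min (enat N * loc_mult g h) (enat (N * k))"
  using assms
proof (induction k arbitrary: N as g h)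
  case 0
  show ?case by (simp flip: zero_enat_def)
next
  case (Suc k)
  note br = \<open>branches N as g\<close>
  note len = branches_length[OF br]
  have N: "N > 0" using br by (simp add: branches_def)
  consider "as = []" | "poly (red h) 0 \<noteq> 0" | "as \<noteq> []" "[:0, 1:] ^ length as dvd red h"
    | "\<not> [:0, 1:] ^ length as dvd red h" "poly (red h) 0 = 0" by blast
  then show ?case
  proof cases
    case 1
    then have "poly (red g) 0 \<noteq> 0" using len by (metis list.size(3) order_root)
    then show ?thesis using 1 by (simp add: loc_mult_unit branch_sum_def)
  next
    case 2
    then show ?thesis
      using branch_sum_unit[OF br] loc_mult_unit[of h g] by (simp add: loc_mult_commute)
  next
    case 3
    then show ?thesis using branch_sum_step[OF br 3(2,1)] Suc.IH[OF br] by blast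
  next
    case 4
    have h0: "red h \<noteq> 0" using 4 by auto
    then obtain M bs where bs: "branches M bs h" using branches_exist by blast
    then have M: "M > 0" by (simp add: branches_def)
    note lenh = branches_length[OF bs]
    have "length bs < length as"
      using 4 order_1[of 0 "red h"] unfolding lenh
      by (metis dvd_trans le_imp_power_dvd minus_zero not_le)
    then have dvd: "[:0, 1:] ^ length bs dvd red g"
      using order_1[of 0 "red g"] unfolding len
      by (metis dvd_trans le_imp_power_dvd minus_zero less_imp_le)
    have "bs \<noteq> []"
      using 4(2) h0 lenh by (metis list.size(3) order_root)
    \<comment> \<open>The induction hypothesis covers every ramification index, so it may be used
      for N M. All quantities are then M times those for N, and M is cancelled at the end.\<close>
    define as' where "as' = map (ramify M) as"
    define bs' where "bs' = map (ramify N) bs"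
    have as': "branches (N * M) as' g"
      using br M unfolding as'_def by (rule branches_ramify)
    have bs': "branches (N * M) bs' h"
      using branches_ramify[OF bs N] unfolding bs'_def by (simp add: mult.commute)
    have "min (branch_sum (N * M) bs' g) (enat (N * M * Suc k))
        = min (enat (N * M) * loc_mult h g) (enat (N * M * Suc k))"
    proof (rule branch_sum_step[OF bs'])
      show "[:0, 1:] ^ length bs' dvd red g" "bs' \<noteq> []"
        using dvd \<open>bs \<noteq> []\<close> by (simp_all add: bs'_def)
    qed (rule Suc.IH[OF bs'])
    moreover have "branch_sum (N * M) bs' g = branch_sum (N * M) as' h"
      unfolding branch_sum_def by (rule branches_symmetric[OF bs' as'])
    moreover have "branch_sum (N * M) as' h = enat M * branch_sum N as h"
      unfolding as'_def by (rule branch_sum_ramify[OF br M])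
    moreover have "enat (N * M * Suc k) = enat M * enat (N * Suc k)"
      "enat (N * M) * loc_mult h g = enat M * (enat N * loc_mult g h)"
      by (simp_all add: loc_mult_commute mult_ac flip: times_enat_simps(1))
    ultimately show ?thesis
      by (simp only: enat_mult_min [OF M, symmetric] enat_mult_cancel[OF M])
  qed
qed

text \<open>Orders are measured in t while z = t^N, whence the factor N. Two values that agree under
  all truncations are equal, also when they are infinite.\<close>

theorem loc_mult_eq_branch_sum:
  assumes "branches N as g"
  shows "enat N * loc_mult g h = branch_sum N as h"
proof -
  have N: "N > 0" using assms by (simp add: branches_def)
  have "a \<le> b" if "\<And>k. min a (enat (N * k)) = min b (enat (N * k))" for a b :: enat
  proof (cases b)
    case (enat n)
    have "n < N * Suc n" using N by (cases N) auto
    then show ?thesis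
      using that[of "Suc n"] unfolding enat by (cases a) (auto simp: min_def split: if_splits)
  qed simp
  then show ?thesis
    using branch_sum_truncated[OF assms, of h] by (metis order_antisym)
qed

section \<open>Polar curves\<close>

abbreviation d_z :: "poly2 \<Rightarrow> poly2"
  where "d_z \<equiv> map_poly pderiv"

lemma deriv_emb: "fps_deriv (emb N c) = emb N (pderiv c) * fps_deriv (fps_X ^ N)"
  unfolding emb_def
  using chain_rule[of fps_const fps_deriv "\<lambda>_. 0" 0 "\<lambda>_. 0" 0 "fps_X ^ N" c]
  by (simp add: is_hom_fps_const)

lemma deriv_along:
  "fps_deriv (along N \<alpha> f) = along N \<alpha> (d_z f) * fps_deriv (fps_X ^ N) + along N \<alpha> (pderiv f) * fps_deriv \<alpha>"
  unfolding along_def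
  using chain_rule[of "emb N" fps_deriv pderiv "fps_deriv (fps_X ^ N)" "\<lambda>_. 0" 0 \<alpha> f]
  by (simp add: is_hom_emb deriv_emb)

lemma X_deriv_nth: "fps_nth (fps_X * fps_deriv \<phi>) k = of_nat k * fps_nth \<phi> k"
  for \<phi> :: "complex fps"
  by (cases k) auto

lemma X_deriv_X_power: "fps_X * fps_deriv (fps_X ^ N) = of_nat N * (fps_X ^ N :: complex fps)"
  by (rule fps_ext) (simp only: X_deriv_nth, simp flip: fps_of_nat)

lemma X_deriv_along:
  assumes "along N \<alpha> (pderiv f) = 0"
  shows "fps_X * fps_deriv (along N \<alpha> f) = of_nat N * along N \<alpha> (var_z * d_z f)"
proof -
  have "fps_X * fps_deriv (along N \<alpha> f) = along N \<alpha> (d_z f) * (fps_X * fps_deriv (fps_X ^ N))"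
    unfolding deriv_along assms by (simp only: mult_zero_left add_0_right mult_ac)
  then show ?thesis
    unfolding X_deriv_X_power along_simps(4) along_z by (simp only: mult_ac)
qed

lemma enat_eqI: "(\<And>n. enat n \<le> a \<longleftrightarrow> enat n \<le> b) \<Longrightarrow> a = b"
proof -
  have "a \<le> b" if "\<And>n. enat n \<le> a \<Longrightarrow> enat n \<le> b" for a b
    using that[of "Suc (the_enat b)"] that by (cases a; cases b) auto
  then show "(\<And>n. enat n \<le> a \<longleftrightarrow> enat n \<le> b) \<Longrightarrow> a = b"
    by (meson order_antisym)
qed

text \<open>The operator t d/dt multiplies the coefficient of t^k by k, so it can lose only the
  constant term.\<close>

lemma fps_ord_X_deriv:
  assumes "fps_nth \<phi> 0 = 0"
  shows "fps_ord (fps_X * fps_deriv \<phi>) = fps_ord \<phi>"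
proof (rule enat_eqI)
  fix n
  have "(of_nat k * fps_nth \<phi> k = 0) = (fps_nth \<phi> k = 0)" for k
    using assms by (cases k) (auto simp del: of_nat_Suc)
  then show "enat n \<le> fps_ord (fps_X * fps_deriv \<phi>) \<longleftrightarrow> enat n \<le> fps_ord \<phi>"
    by (simp only: fps_ord_ge_iff X_deriv_nth)
qed

text \<open>Along a branch of the polar curve \<open>f\<^sub>y = 0\<close> only \<open>z\<close> contributes to the derivative of \<open>f\<close>,
  which makes \<open>f\<close> and \<open>z f\<^sub>z\<close> vanish to the same order.\<close>

lemma ord_along_polar_branch:
  assumes br: "branches N as (pderiv f)" "\<alpha> \<in> set as" and f0: "poly (red f) 0 = 0"
  shows "fps_ord (along N \<alpha> (var_z * d_z f)) = fps_ord (along N \<alpha> f)"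
proof -
  have N: "N > 0" "fps_nth \<alpha> 0 = 0" using br by (auto simp: branches_def)
  have "fps_ord (of_nat N * along N \<alpha> (var_z * d_z f)) = fps_ord (along N \<alpha> f)"
    using fps_ord_X_deriv[of "along N \<alpha> f"] X_deriv_along[of N \<alpha> f] branches_root[OF br]
      along_nth_0[OF N, of f] f0 by simp
  moreover have "fps_ord (of_nat N :: complex fps) = 0"
    using N by (intro fps_ord_unit) simp
  ultimately show ?thesis by (simp add: fps_ord_mult)
qed

lemma red_pderiv: "red (pderiv f) = pderiv (red f)"
  by (intro poly_eqI) (simp add: red_def coeff_map_poly coeff_pderiv)

text \<open>A nonzero polynomial with a zero at 0 is not constant, and in characteristic 0
  differentiation lowers the order of that zero by exactly one. This is the origin of the -1 in the
  inequality.\<close>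

lemma order_red_pderiv:
  assumes "red f \<noteq> 0" "poly (red f) 0 = 0"
  shows "red (pderiv f) \<noteq> 0" "order 0 (red f) = Suc (order 0 (red (pderiv f)))"
proof -
  show "red (pderiv f) \<noteq> 0"
    using assms unfolding red_pderiv pderiv_eq_0_iff by (metis degree_eq_zeroE poly_pCons mult_zero_left add_0_right pCons_0_0 poly_0)
  show "order 0 (red f) = Suc (order 0 (red (pderiv f)))"
    using assms unfolding red_pderiv by (rule order_pderiv)
qed

text \<open>The order of \<open>red (pderiv f)\<close> at 0 is i(f_y, z). The first part is
  Teissier's formula; the second is applied with the degree d for \<open>a\<close> and the
  coordinate y for \<open>b\<close>.\<close>

lemma loc_mult_polar:
  assumes f: "red f \<noteq> 0" "poly (red f) 0 = 0"
  shows "loc_mult (pderiv f) f = enat (order 0 (red (pderiv f))) + loc_mult (pderiv f) (d_z f)"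
    and "enat (order 0 (red (pderiv f))) + loc_mult (pderiv f) (d_z f)
      \<le> loc_mult (pderiv f) (a * f - b * pderiv f - var_z * d_z f)"
proof -
  obtain N as where br: "branches N as (pderiv f)"
    using branches_exist order_red_pderiv[OF f] by blast
  then have N: "N > 0" by (simp add: branches_def)
  obtain u where "red (pderiv f) = [:0, 1:] ^ order 0 (red (pderiv f)) * u" "poly u 0 \<noteq> 0"
    using red_eq_X_power_mult order_red_pderiv[OF f] by metis
  then have z: "loc_mult (pderiv f) (var_z * d_z f) = enat (order 0 (red (pderiv f))) + loc_mult (pderiv f) (d_z f)"
    by (rule loc_mult_var_z)
  note ord = ord_along_polar_branch[OF br _ f(2)]
  have "branch_sum N as f = branch_sum N as (var_z * d_z f)"
    unfolding branch_sum_def using ord by (intro arg_cong[of _ _ sum_list] map_cong) auto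
  then have "loc_mult (pderiv f) f = loc_mult (pderiv f) (var_z * d_z f)"
    using enat_mult_cancel[OF N] by (simp only: loc_mult_eq_branch_sum[OF br, symmetric])
  then show "loc_mult (pderiv f) f = enat (order 0 (red (pderiv f))) + loc_mult (pderiv f) (d_z f)"
    using z by simp
  \<comment> \<open>On a branch of f_y the term with \<open>b\<close> vanishes, and a f has at least
    the order of z f_z, so the difference has at least that order too.\<close>
  have "fps_ord (along N \<alpha> (var_z * d_z f)) \<le> fps_ord (along N \<alpha> (a * f - b * pderiv f - var_z * d_z f))"
    if "\<alpha> \<in> set as" for \<alpha>
  proof -
    have "along N \<alpha> (a * f - b * pderiv f - var_z * d_z f)
        = along N \<alpha> a * along N \<alpha> f - along N \<alpha> (var_z * d_z f)"
      using branches_root[OF br that] by (simp only: along_simps mult_zero_right diff_zero)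
    moreover have "fps_ord (along N \<alpha> (var_z * d_z f)) \<le> fps_ord (along N \<alpha> a * along N \<alpha> f)"
      by (simp only: fps_ord_mult ord[OF that]) simp
    ultimately show ?thesis by (simp only: fps_ord_diff_ge order_refl)
  qed
  then have "branch_sum N as (var_z * d_z f) \<le> branch_sum N as (a * f - b * pderiv f - var_z * d_z f)"
    unfolding branch_sum_def by (intro sum_list_mono) auto
  then show "enat (order 0 (red (pderiv f))) + loc_mult (pderiv f) (d_z f)
      \<le> loc_mult (pderiv f) (a * f - b * pderiv f - var_z * d_z f)"
    using enat_mult_le_cancel[OF N] z by (simp only: loc_mult_eq_branch_sum[OF br, symmetric])
qed

section \<open>Dehomogenization\<close>

abbreviation vx :: poly3 where "vx \<equiv> [:[:[:0, 1:]:]:]"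
abbreviation vy :: poly3 where "vy \<equiv> [:[:0, 1:]:]"

lemma is_hom_const3: "is_hom const3"
  by (simp add: is_hom_def const3_def one_pCons)

lemma hom_ext_poly3:
  fixes h k :: "poly3 \<Rightarrow> 'a::comm_ring_1"
  assumes h: "is_hom h" and k: "is_hom k"
    and "\<And>c. h (const3 c) = k (const3 c)" "h vx = k vx" "h vy = k vy" "h varz = k varz"
  shows "h F = k F"
proof -
  have hom1: "is_hom (\<lambda>P. f [:[:P:]:])" and hom2: "is_hom (\<lambda>P. f [:P:])"
    if f: "is_hom f" for f :: "poly3 \<Rightarrow> 'a"
  proof -
    have "is_hom (\<lambda>P :: complex poly. [:[:P:]:])" by (simp add: is_hom_def one_pCons)
    with f show "is_hom (\<lambda>P. f [:[:P:]:])" by (rule is_hom_comp)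
    show "is_hom (\<lambda>P. f [:P:])" using f is_hom_const_poly by (rule is_hom_comp)
  qed
  have 1: "h [:[:P:]:] = k [:[:P:]:]" for P
    using hom_ext_poly[where h = "\<lambda>P. h [:[:P:]:]" and k = "\<lambda>P. k [:[:P:]:]" and P = P]
      hom1[OF h] hom1[OF k] assms(3,4) by (simp add: const3_def)
  have 2: "h [:P:] = k [:P:]" for P
    using hom_ext_poly[where h = "\<lambda>P. h [:P:]" and k = "\<lambda>P. k [:P:]" and P = P]
      hom2[OF h] hom2[OF k] assms(5) 1 by simp
  show ?thesis
    using hom_ext_poly[where h = h and k = k and P = F] h k assms(6) 2 by (simp add: varz_def)
qed

lemma is_hom_eval3: "is_hom (\<lambda>F. eval3 F v)"
  by (simp add: is_hom_def eval3_def)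

lemmas eval3_simps = is_homD[OF is_hom_eval3] is_hom_power[OF is_hom_eval3]

lemma eval3_vars [simp]:
  "eval3 (const3 c) v = c" "eval3 vx v = v $ 1" "eval3 vy v = v $ 2" "eval3 varz v = v $ 3"
  by (simp_all add: eval3_def const3_def varz_def)

definition affine_coord :: "complex ^ 3 \<Rightarrow> complex ^ 3 \<Rightarrow> complex ^ 3 \<Rightarrow> 3 \<Rightarrow> poly2"
  where "affine_coord p q r i = [:[:p $ i, r $ i:], [:q $ i:]:]"

text \<open>The polynomial \<open>F(p + y q + z r)\<close>.\<close>

definition dehom :: "complex ^ 3 \<Rightarrow> complex ^ 3 \<Rightarrow> complex ^ 3 \<Rightarrow> poly3 \<Rightarrow> poly2"
  where "dehom p q r = eval_hom (eval_hom (eval_hom (\<lambda>c. [:[:c:]:]) (affine_coord p q r 1))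
    (affine_coord p q r 2)) (affine_coord p q r 3)"

lemma is_hom_const2: "is_hom (\<lambda>c :: complex. [:[:c:]:])"
  by (simp add: is_hom_def one_pCons)

lemma is_hom_dehom: "is_hom (dehom p q r)"
  unfolding dehom_def by (intro is_hom_eval_hom is_hom_const2)

lemmas dehom_simps = is_homD[OF is_hom_dehom] is_hom_power[OF is_hom_dehom] is_hom_of_nat[OF is_hom_dehom]

lemma dehom_vars [simp]:
  "dehom p q r (const3 c) = [:[:c:]:]" "dehom p q r vx = affine_coord p q r 1"
  "dehom p q r vy = affine_coord p q r 2" "dehom p q r varz = affine_coord p q r 3"
  by (simp_all add: dehom_def const3_def varz_def eval_hom_pCons is_homD[OF is_hom_const2]
      is_homD[OF is_hom_eval_hom[OF is_hom_const2]]
      is_homD[OF is_hom_eval_hom[OF is_hom_eval_hom[OF is_hom_const2]]])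

lemma eval_dehom: "poly (poly (dehom p q r F) [:a:]) b = eval3 F (p + a *s q + b *s r)"
proof (rule hom_ext_poly3[where h = "\<lambda>F. poly (poly (dehom p q r F) [:a:]) b"
      and k = "\<lambda>F. eval3 F (p + a *s q + b *s r)"])
  show "is_hom (\<lambda>F. poly (poly (dehom p q r F) [:a:]) b)"
    using is_hom_comp[of "\<lambda>P. poly (poly P [:a:]) b" "dehom p q r"] is_hom_dehom
    by (simp add: is_hom_def)
qed (auto simp: affine_coord_def is_hom_eval3)

lemma poly_red: "poly (red f) a = poly (poly f [:a:]) 0"
  by (induction f) (auto simp: red_def map_poly_pCons)

lemma poly_red_dehom: "poly (red (dehom p q r F)) a = eval3 F (p + a *s q)"
  by (simp add: poly_red eval_dehom)

lemma poly_red_dehom_0: "poly (red (dehom p q r F)) 0 = eval3 F p"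
  by (simp add: poly_red_dehom)

lemma chain_rule3:
  fixes D :: "poly2 \<Rightarrow> poly2"
  assumes add: "\<And>a b. D (a + b) = D a + D b" and mult: "\<And>a b. D (a * b) = a * D b + D a * b"
    and const: "\<And>c. D [:[:c:]:] = 0"
  shows "D (dehom p q r F) = dehom p q r (Dx F) * D (affine_coord p q r 1)
    + dehom p q r (Dy F) * D (affine_coord p q r 2) + dehom p q r (Dz F) * D (affine_coord p q r 3)"
proof -
  define h where "h = (\<lambda>c :: complex. [:[:c:]:])"
  have h: "is_hom h" unfolding h_def by (rule is_hom_const2)
  have D0: "D (h c) = 0" for c by (simp add: h_def const)
  have 1: "D (eval_hom h X P) = eval_hom h X (pderiv P) * D X" for X P
    using chain_rule[of h D "\<lambda>_. 0" 0 "\<lambda>_. 0" 0 X P] h add mult by (simp add: D0)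
  have 2: "D (eval_hom (eval_hom h X) Y P) = eval_hom (eval_hom h X) Y (map_poly pderiv P) * D X
    + eval_hom (eval_hom h X) Y (pderiv P) * D Y" for X Y P
    using chain_rule[of "eval_hom h X" D pderiv "D X" "\<lambda>_. 0" 0 Y P] add mult 1
    by (simp add: h is_hom_eval_hom)
  show ?thesis
    unfolding dehom_def Dx_def Dy_def Dz_def h_def [symmetric]
    using chain_rule[of _ D "map_poly pderiv" _ pderiv, OF is_hom_eval_hom[OF is_hom_eval_hom[OF h]] add mult 2]
    by simp
qed

lemma dehom_polar:
  "dehom p q r (polar F v) = [:[:v $ 1:]:] * dehom p q r (Dx F) + [:[:v $ 2:]:] * dehom p q r (Dy F)
    + [:[:v $ 3:]:] * dehom p q r (Dz F)"
  by (simp add: polar_def dehom_simps)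

text \<open>Moving y moves the point p + y q + z r in the direction q. Thus polars of F correspond
  to partial derivatives of its affine equation.\<close>

lemma pderiv_dehom: "pderiv (dehom p q r F) = dehom p q r (polar F q)"
  unfolding dehom_polar
  by (subst chain_rule3[of pderiv])
    (simp_all add: pderiv_add pderiv_mult pderiv_pCons affine_coord_def algebra_simps)

lemma d_z_add: "d_z (a + b) = d_z a + d_z b"
  by (intro poly_eqI) (simp add: coeff_map_poly pderiv_add)

lemma d_z_mult: "d_z (a * b) = a * d_z b + d_z a * b"
proof (induction a)
  case (pCons c a)
  have "d_z (smult c b) = smult c (d_z b) + smult (pderiv c) b"
    by (intro poly_eqI) (simp add: coeff_map_poly pderiv_mult mult.commute)
  with pCons show ?case
    by (simp add: d_z_add map_poly_pCons algebra_simps)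
qed simp

lemma d_z_dehom: "d_z (dehom p q r F) = dehom p q r (polar F r)"
  unfolding dehom_polar
  by (subst chain_rule3[of d_z])
    (simp_all add: d_z_add d_z_mult map_poly_pCons pderiv_pCons affine_coord_def algebra_simps)

section \<open>Homogeneous polynomials\<close>

lemma coeff3_mult: "coeff3 (F * G) i j k
    = (\<Sum>c\<le>k. \<Sum>b\<le>j. \<Sum>a\<le>i. coeff3 F a b c * coeff3 G (i - a) (j - b) (k - c))"
  by (simp add: coeff3_def coeff_mult coeff_sum)

lemma homogeneous_mult:
  assumes "homogeneous d F" "homogeneous e G"
  shows "homogeneous (d + e) (F * G)"
  unfolding homogeneous_def
proof (intro allI impI)
  fix i j k assume "coeff3 (F * G) i j k \<noteq> 0"
  then obtain a b c where "c \<le> k" "b \<le> j" "a \<le> i"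
    and nz: "coeff3 F a b c * coeff3 G (i - a) (j - b) (k - c) \<noteq> 0"
    unfolding coeff3_mult by (metis (no_types, lifting) atMost_iff sum.neutral)
  then have "a + b + c = d" "(i - a) + (j - b) + (k - c) = e"
    using assms unfolding homogeneous_def by (metis mult_eq_0_iff)+
  then show "i + j + k = d + e"
    using \<open>c \<le> k\<close> \<open>b \<le> j\<close> \<open>a \<le> i\<close> by linarith
qed

lemma homogeneous_add: "homogeneous d F \<Longrightarrow> homogeneous d G \<Longrightarrow> homogeneous d (F + G)"
  unfolding homogeneous_def coeff3_def by (metis add.right_neutral coeff_add)

lemma homogeneous_0: "homogeneous d 0"
  by (simp add: homogeneous_def coeff3_def)

lemma homogeneous_const3: "homogeneous 0 (const3 c)"
  by (auto simp: homogeneous_def coeff3_def const3_def coeff_pCons split: nat.splits)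

lemma homogeneous_vars: "homogeneous 1 vx" "homogeneous 1 vy" "homogeneous 1 varz"
  by (auto simp: homogeneous_def coeff3_def varz_def coeff_pCons one_pCons split: nat.splits)

lemma homogeneous_const3_mult: "homogeneous d F \<Longrightarrow> homogeneous d (const3 c * F)"
  using homogeneous_mult[OF homogeneous_const3, of d F] by simp

lemma homogeneous_sum: "(\<And>i. i \<in> I \<Longrightarrow> homogeneous d (F i)) \<Longrightarrow> homogeneous d (sum F I)"
  by (induction I rule: infinite_finite_induct) (auto intro: homogeneous_0 homogeneous_add)

lemma homogeneous_power: "homogeneous d F \<Longrightarrow> homogeneous (n * d) (F ^ n)"
proof (induction n)
  case 0
  then show ?case using homogeneous_const3[of 1] by (simp add: is_homD[OF is_hom_const3])
qed (auto intro: homogeneous_mult)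

lemma coeff3_derivs:
  "coeff3 (Dx F) i j k = of_nat (Suc i) * coeff3 F (Suc i) j k"
  "coeff3 (Dy F) i j k = of_nat (Suc j) * coeff3 F i (Suc j) k"
  "coeff3 (Dz F) i j k = of_nat (Suc k) * coeff3 F i j (Suc k)"
  by (simp_all add: coeff3_def Dx_def Dy_def Dz_def coeff_map_poly coeff_pderiv of_nat_poly del: of_nat_Suc)

lemma homogeneous_derivs:
  assumes "homogeneous d F"
  shows "homogeneous (d - 1) (Dx F)" "homogeneous (d - 1) (Dy F)" "homogeneous (d - 1) (Dz F)"
proof -
  have *: "coeff3 F i j k \<noteq> 0 \<Longrightarrow> i + j + k = d" for i j k
    using assms by (simp add: homogeneous_def)
  have "i + j + k = d - 1" if "coeff3 F (Suc i) j k \<noteq> 0" for i j k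
    using *[OF that] by simp
  then show "homogeneous (d - 1) (Dx F)"
    unfolding homogeneous_def coeff3_derivs by (metis mult_zero_right)
  have "i + j + k = d - 1" if "coeff3 F i (Suc j) k \<noteq> 0" for i j k
    using *[OF that] by simp
  then show "homogeneous (d - 1) (Dy F)"
    unfolding homogeneous_def coeff3_derivs by (metis mult_zero_right)
  have "i + j + k = d - 1" if "coeff3 F i j (Suc k) \<noteq> 0" for i j k
    using *[OF that] by simp
  then show "homogeneous (d - 1) (Dz F)"
    unfolding homogeneous_def coeff3_derivs by (metis mult_zero_right)
qed

lemma coeff3_ext: "(\<And>i j k. coeff3 F i j k = coeff3 G i j k) \<Longrightarrow> F = G"
  unfolding coeff3_def by (intro poly_eqI)

lemma euler_identity:
  assumes "homogeneous d F"
  shows "vx * Dx F + vy * Dy F + varz * Dz F = of_nat d * F"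
proof (rule coeff3_ext)
  fix i j k
  have "coeff3 (vx * Dx F) i j k = of_nat i * coeff3 F i j k"
    using coeff3_derivs(1)[of F] by (cases i) (auto simp: coeff3_def coeff_pCons)
  moreover have "coeff3 (vy * Dy F) i j k = of_nat j * coeff3 F i j k"
    using coeff3_derivs(2)[of F] by (cases j) (auto simp: coeff3_def coeff_pCons)
  moreover have "coeff3 (varz * Dz F) i j k = of_nat k * coeff3 F i j k"
    using coeff3_derivs(3)[of F] by (cases k) (auto simp: coeff3_def varz_def coeff_pCons)
  ultimately have "coeff3 (vx * Dx F + vy * Dy F + varz * Dz F) i j k = of_nat (i + j + k) * coeff3 F i j k"
    by (simp add: coeff3_def algebra_simps)
  also have "\<dots> = of_nat d * coeff3 F i j k"
    using assms unfolding homogeneous_def by (cases "coeff3 F i j k = 0") auto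
  also have "\<dots> = coeff3 (of_nat d * F) i j k"
    by (simp add: coeff3_def of_nat_poly)
  finally show "coeff3 (vx * Dx F + vy * Dy F + varz * Dz F) i j k = coeff3 (of_nat d * F) i j k" .
qed

abbreviation var_y :: poly2 where "var_y \<equiv> [:0, 1:]"

lemma affine_coord_eq: "affine_coord p q r i = [:[:p $ i:]:] + var_y * [:[:q $ i:]:] + var_z * [:[:r $ i:]:]"
  by (simp add: affine_coord_def)

text \<open>Euler's identity at the point p + y q + z r, combined with the linearity of the polar in
  its direction: d F = F_(p) + y F_(q) + z F_(r).\<close>

lemma dehom_polar_base_point:
  assumes "homogeneous d F"
  shows "dehom p q r (polar F p)
    = of_nat d * dehom p q r F - var_y * pderiv (dehom p q r F) - var_z * d_z (dehom p q r F)"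
proof -
  have "of_nat d * dehom p q r F = dehom p q r (vx * Dx F + vy * Dy F + varz * Dz F)"
    unfolding euler_identity[OF assms] by (simp only: dehom_simps)
  also have "\<dots> = affine_coord p q r 1 * dehom p q r (Dx F) + affine_coord p q r 2 * dehom p q r (Dy F)
      + affine_coord p q r 3 * dehom p q r (Dz F)"
    by (simp only: dehom_simps dehom_vars)
  also have "\<dots> = dehom p q r (polar F p) + var_y * dehom p q r (polar F q) + var_z * dehom p q r (polar F r)"
    unfolding dehom_polar affine_coord_eq by (simp only: algebra_simps)
  finally show ?thesis
    unfolding pderiv_dehom d_z_dehom by (simp only: algebra_simps)
qed

text \<open>In a nested polynomial ring the coefficient of X^k carries the remaining degree e - k,
  so that a homogeneous polynomial can be scaled one variable at a time.\<close>

lemma eval_hom_scale: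
  assumes h0: "h 0 = 0" and h'0: "h' 0 = 0"
    and "\<And>k. coeff P k \<noteq> 0 \<Longrightarrow> k \<le> e \<and> h' (coeff P k) = c ^ (e - k) * h (coeff P k)"
  shows "eval_hom h' (c * X) P = c ^ e * eval_hom h X P"
proof -
  have "h' (coeff P k) * (c * X) ^ k = c ^ e * (h (coeff P k) * X ^ k)" for k
  proof (cases "coeff P k = 0")
    case False
    then have "k \<le> e" "h' (coeff P k) = c ^ (e - k) * h (coeff P k)" using assms by auto
    moreover from this have "c ^ e = c ^ (e - k) * c ^ k" by (simp flip: power_add)
    ultimately show ?thesis
      by (simp only: power_mult_distrib mult_ac)
  qed (simp add: h0 h'0)
  then show ?thesis
    by (simp add: eval_hom_altdef[where n = "degree P"] h0 h'0 sum_distrib_left)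
qed

lemma eval3_scale:
  assumes "homogeneous e F"
  shows "eval3 F (c *s v) = c ^ e * eval3 F v"
proof -
  have id: "is_hom (\<lambda>c :: complex. c)" by (simp add: is_hom_def)
  define E1 where "E1 v = eval_hom (\<lambda>c. c) (v $ 1)" for v :: "complex ^ 3"
  define E2 where "E2 v = eval_hom (E1 v) (v $ 2)" for v
  have hom1: "is_hom (E1 v)" for v unfolding E1_def by (intro is_hom_eval_hom id)
  have hom2: "is_hom (E2 v)" for v unfolding E2_def by (intro is_hom_eval_hom hom1)
  have hom3: "is_hom (eval_hom (E2 v) (v $ 3))" for v by (intro is_hom_eval_hom hom2)
  have E: "eval3 F v = eval_hom (E2 v) (v $ 3) F" for v
  proof (rule hom_ext_poly3[where h = "\<lambda>F. eval3 F v" and k = "eval_hom (E2 v) (v $ 3)"])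
    show "is_hom (\<lambda>F. eval3 F v)" by (rule is_hom_eval3)
    show "is_hom (eval_hom (E2 v) (v $ 3))" by (rule hom3)
  qed (simp_all add: const3_def varz_def eval3_def eval_hom_pCons E1_def E2_def
      is_homD[OF is_hom_eval_hom[OF id]] is_homD[OF is_hom_eval_hom[OF is_hom_eval_hom[OF id]]])
  have 0: "i + j + k = e" if "coeff (coeff (coeff F k) j) i \<noteq> 0" for i j k
    using assms that by (simp add: homogeneous_def coeff3_def)
  have 1: "E1 (c *s v) (coeff (coeff F k) j) = c ^ (e - k - j) * E1 v (coeff (coeff F k) j)" for j k
    unfolding E1_def vector_smult_component
    by (intro eval_hom_scale) (use 0[of k j] in force)+
  have jk: "j + k \<le> e" if "coeff (coeff F k) j \<noteq> 0" for j k
    using that 0[of k j "degree (coeff (coeff F k) j)"] leading_coeff_0_iff[of "coeff (coeff F k) j"] by linarith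
  have 2: "E2 (c *s v) (coeff F k) = c ^ (e - k) * E2 v (coeff F k)" for k
    unfolding E2_def vector_smult_component
  proof (rule eval_hom_scale)
    fix j assume "coeff (coeff F k) j \<noteq> 0"
    then have "j \<le> e - k" using jk[of k j] by linarith
    then show "j \<le> e - k \<and>
        E1 (c *s v) (coeff (coeff F k) j) = c ^ (e - k - j) * E1 v (coeff (coeff F k) j)"
      using 1 by blast
  qed (simp_all only: is_homD[OF hom1])
  have k: "k \<le> e" if "coeff F k \<noteq> 0" for k
    using that jk[of k "degree (coeff F k)"] leading_coeff_0_iff[of "coeff F k"] by linarith
  show ?thesis
    unfolding E vector_smult_component
    by (intro eval_hom_scale) (auto simp: is_homD[OF hom2] 2 k)
qed

lemma poly_eq_0_if_infinite_roots:
  fixes P :: "'a::idom poly" and \<kappa> :: "complex \<Rightarrow> 'a"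
  assumes "inj \<kappa>" "\<And>c. poly P (\<kappa> c) = 0"
  shows "P = 0"
proof (rule ccontr)
  assume "P \<noteq> 0"
  then have "finite {x. poly P x = 0}" by (rule poly_roots_finite)
  then have "finite (range \<kappa>)" by (rule finite_subset[rotated]) (use assms in auto)
  then show False using assms(1) infinite_UNIV_char_0 by (metis finite_imageD)
qed

lemma poly3_eq_0:
  assumes "\<And>v. eval3 F v = 0"
  shows "F = 0"
proof -
  have "poly (poly (poly F [:[:z:]:]) [:y:]) x = 0" for x y z
    using assms[of "vector [x, y, z]"] by (simp add: eval3_def)
  then have "poly (poly F [:[:z:]:]) [:y:] = 0" for y z
    by (metis poly_all_0_iff_0)
  then have "poly F [:[:z:]:] = 0" for z
    by (intro poly_eq_0_if_infinite_roots[of "\<lambda>y. [:y:]"]) (auto simp: inj_def)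
  then show ?thesis
    by (intro poly_eq_0_if_infinite_roots[of "\<lambda>z. [:[:z:]:]"]) (auto simp: inj_def)
qed

definition lin :: "complex ^ 3 \<Rightarrow> poly3"
  where "lin w = const3 (w $ 1) * vx + const3 (w $ 2) * vy + const3 (w $ 3) * varz"

lemma homogeneous_lin: "homogeneous 1 (lin w)"
  unfolding lin_def by (intro homogeneous_add homogeneous_const3_mult homogeneous_vars)

lemma eval3_lin: "eval3 (lin w) v = (\<Sum>i\<in>UNIV. w $ i * v $ i)"
  by (simp only: lin_def eval3_simps eval3_vars sum_3)

lemma dehom_lin: "dehom p q r (lin w)
    = [:[:eval3 (lin w) p:]:] + var_y * [:[:eval3 (lin w) q:]:] + var_z * [:[:eval3 (lin w) r:]:]"
  unfolding eval3_lin sum_3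
  by (simp only: lin_def dehom_simps dehom_vars) (simp add: affine_coord_def algebra_simps)

section \<open>Intersection numbers in affine coordinates\<close>

text \<open>No nonzero linear form vanishes on all three vectors, so they are a basis: p is the
  origin of the chart, q and r are the directions of its axes.\<close>

locale frame =
  fixes p q r :: "complex ^ 3"
  assumes not_collinear: "\<not> collinear3 p q r"
begin

text \<open>The dual forms are the columns of the inverse of the matrix with rows p, q, r. A nonzero
  kernel vector of this matrix would be a line through the three points.\<close>

lemma dual_basis:
  obtains l m n where
    "eval3 (lin l) p = 1" "eval3 (lin l) q = 0" "eval3 (lin l) r = 0"
    "eval3 (lin m) p = 0" "eval3 (lin m) q = 1" "eval3 (lin m) r = 0"
    "eval3 (lin n) p = 0" "eval3 (lin n) q = 0" "eval3 (lin n) r = 1"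
    "\<And>v. v = eval3 (lin l) v *s p + eval3 (lin m) v *s q + eval3 (lin n) v *s r"
proof -
  define A :: "complex ^ 3 ^ 3" where "A = vector [p, q, r]"
  have A: "A $ 1 = p" "A $ 2 = q" "A $ 3 = r" by (simp_all add: A_def)
  have "x = 0" if "A *v x = 0" for x
  proof (rule ccontr)
    assume "x \<noteq> 0"
    have "(\<Sum>i\<in>UNIV. A $ j $ i * x $ i) = 0" for j
      using that unfolding matrix_vector_mult_def vec_eq_iff by simp
    then have "\<forall>v\<in>{p, q, r}. (\<Sum>i\<in>UNIV. x $ i * v $ i) = 0"
      unfolding A [symmetric] by (auto simp: mult.commute)
    then show False using not_collinear \<open>x \<noteq> 0\<close> unfolding collinear3_def by blast
  qed
  then have "\<exists>B. B ** A = mat 1"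
    by (simp add: matrix_left_invertible_ker)
  then obtain B where BA: "B ** A = mat 1" ..
  then have AB: "A ** B = mat 1"
    by (simp add: matrix_left_right_inverse)
  define u where "u j = (\<chi> k. B $ k $ j)" for j
  have ev: "eval3 (lin (u j)) (A $ i) = (if i = j then 1 else 0)" for i j
    using arg_cong[OF AB, of "\<lambda>M. M $ i $ j"]
    by (simp add: eval3_lin u_def matrix_matrix_mult_def mat_def mult.commute)
  have "v = eval3 (lin (u 1)) v *s A $ 1 + eval3 (lin (u 2)) v *s A $ 2 + eval3 (lin (u 3)) v *s A $ 3" for v
  proof -
    have "v v* (B ** A) = v" unfolding BA by simp
    then have "(v v* B) v* A = v" by (simp add: vector_matrix_mul_assoc)
    moreover have "(v v* B) $ j = eval3 (lin (u j)) v" for j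
      by (simp add: vector_matrix_mult_def eval3_lin u_def mult.commute)
    moreover have "w v* A = w $ 1 *s A $ 1 + w $ 2 *s A $ 2 + w $ 3 *s A $ 3" for w
      by (simp add: vec_eq_iff vector_matrix_mult_def sum_3 mult.commute)
    ultimately show ?thesis by metis
  qed
  moreover have "eval3 (lin (u j)) p = (if j = 1 then 1 else 0)"
    "eval3 (lin (u j)) q = (if j = 2 then 1 else 0)" "eval3 (lin (u j)) r = (if j = 3 then 1 else 0)" for j
    using ev[of j 1] ev[of j 2] ev[of j 3] unfolding A by auto
  ultimately show thesis
    unfolding A by (intro that[of "u 1" "u 2" "u 3"]) simp_all
qed

text \<open>Let l be the form that is 1 on the chart. The difference \<open>K\<close> vanishes on
  the chart, hence by homogeneity wherever l does not, so that K l vanishes everywhere.\<close>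

lemma dehom_inj:
  assumes "homogeneous e F" "homogeneous e G" "dehom p q r F = dehom p q r G"
  shows "F = G"
proof -
  define K where "K = F + const3 (- 1) * G"
  have K: "homogeneous e K"
    unfolding K_def using assms by (intro homogeneous_add homogeneous_const3_mult)
  have K0: "eval3 K (p + a *s q + b *s r) = 0" for a b
    using assms(3) unfolding eval_dehom [symmetric] by (simp add: K_def dehom_simps)
  obtain l m n where l: "eval3 (lin l) p = 1"
    and dec: "\<And>v. v = eval3 (lin l) v *s p + eval3 (lin m) v *s q + eval3 (lin n) v *s r"
    by (rule dual_basis) blast
  have "eval3 (K * lin l) v = 0" for v
  proof (cases "eval3 (lin l) v = 0")
    case False
    let ?c = "eval3 (lin l) v"
    have "v = ?c *s (p + (eval3 (lin m) v / ?c) *s q + (eval3 (lin n) v / ?c) *s r)"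
      using False dec[of v] by (simp add: vector_add_ldistrib vector_smult_assoc)
    then have "eval3 K v = 0"
      using eval3_scale[OF K] K0 by (metis mult_zero_right)
    then show ?thesis by (simp add: eval3_simps)
  qed (simp add: eval3_simps)
  then have "K * lin l = 0" by (rule poly3_eq_0)
  moreover have "lin l \<noteq> 0" using l by (auto simp: eval3_simps)
  ultimately have "K = 0" by simp
  moreover have "const3 (- 1) = - 1"
    using is_hom_minus(1)[OF is_hom_const3, of 1] by (simp add: is_homD[OF is_hom_const3])
  ultimately show "F = G" by (simp add: K_def)
qed

lemma denominator:
  obtains L where "homogeneous 1 L" "eval3 L p = 1" "dehom p q r L = 1"
proof -
  obtain l where l: "eval3 (lin l) p = 1" "eval3 (lin l) q = 0" "eval3 (lin l) r = 0"
    by (rule dual_basis) blast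
  then show thesis
    using that[of "lin l"] homogeneous_lin[of l] dehom_lin[of p q r l] by (simp add: one_pCons)
qed

text \<open>Powers of the form that is 1 on the chart raise the degree freely. Existence in all
  large degrees allows finitely many polynomials to be lifted to prescribed or common
  degrees.\<close>

lemma homogenization: "\<exists>e0. \<forall>e\<ge>e0. \<exists>A. homogeneous e A \<and> dehom p q r A = a"
proof -
  obtain l m n where lin: "eval3 (lin l) p = 1" "eval3 (lin l) q = 0" "eval3 (lin l) r = 0"
    "eval3 (lin m) p = 0" "eval3 (lin m) q = 1" "eval3 (lin m) r = 0"
    "eval3 (lin n) p = 0" "eval3 (lin n) q = 0" "eval3 (lin n) r = 1"
    by (rule dual_basis) blast
  have l: "dehom p q r (lin l) = 1" and m: "dehom p q r (lin m) = var_y" and n: "dehom p q r (lin n) = var_z"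
    unfolding dehom_lin lin by (simp_all add: one_pCons)
  have const: "\<exists>A. homogeneous e A \<and> dehom p q r A = [:[:c:]:]" for e c
    using homogeneous_mult[OF homogeneous_const3 homogeneous_power[OF homogeneous_lin, of e l], of c]
    by (intro exI[of _ "const3 c * lin l ^ e"]) (simp add: dehom_simps l)
  have z: "\<exists>e0. \<forall>e\<ge>e0. \<exists>A. homogeneous e A \<and> dehom p q r A = [:c:]" for c
  proof (induction c)
    case 0
    show ?case using const[of _ 0] by simp
  next
    case (pCons x c)
    then obtain e0 where e0: "\<And>e. e \<ge> e0 \<Longrightarrow> \<exists>A. homogeneous e A \<and> dehom p q r A = [:c:]" by blast
    have "\<exists>A. homogeneous e A \<and> dehom p q r A = [:pCons x c:]" if "e \<ge> Suc e0" for e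
    proof -
      have "e0 \<le> e - 1" using that by simp
      obtain A B where A: "homogeneous (e - 1) A" "dehom p q r A = [:c:]"
        and B: "homogeneous e B" "dehom p q r B = [:[:x:]:]"
        using e0[of "e - 1"] const[of e x] \<open>e0 \<le> e - 1\<close> by blast
      have "homogeneous e (B + lin n * A)"
        using homogeneous_add[OF B(1)] homogeneous_mult[OF homogeneous_lin[of n] A(1)] that by simp
      moreover have "dehom p q r (B + lin n * A) = [:pCons x c:]"
        by (simp add: dehom_simps A B n)
      ultimately show ?thesis by blast
    qed
    then show ?case by blast
  qed
  show ?thesis
  proof (induction a)
    case 0
    show ?case using const[of _ 0] by simp
  next
    case (pCons c a)
    then obtain e0 where e0: "\<And>e. e \<ge> e0 \<Longrightarrow> \<exists>A. homogeneous e A \<and> dehom p q r A = a" by blast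
    obtain e1 where e1: "\<And>e. e \<ge> e1 \<Longrightarrow> \<exists>A. homogeneous e A \<and> dehom p q r A = [:c:]" using z by blast
    have "\<exists>A. homogeneous e A \<and> dehom p q r A = pCons c a" if "e \<ge> max (Suc e0) e1" for e
    proof -
      have "e0 \<le> e - 1" "e1 \<le> e" using that by auto
      obtain A B where A: "homogeneous (e - 1) A" "dehom p q r A = a"
        and B: "homogeneous e B" "dehom p q r B = [:c:]"
        using e0[of "e - 1"] e1[of e] \<open>e0 \<le> e - 1\<close> \<open>e1 \<le> e\<close> by blast
      have "homogeneous e (B + lin m * A)"
        using homogeneous_add[OF B(1)] homogeneous_mult[OF homogeneous_lin[of m] A(1)] that by simp
      moreover have "dehom p q r (B + lin m * A) = pCons c a"
        by (simp add: dehom_simps A B m)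
      ultimately show ?thesis by blast
    qed
    then show ?case by blast
  qed
qed

lemma eval3_nonzero: "eval3 H p \<noteq> 0 \<Longrightarrow> H \<noteq> 0"
  by (auto simp: eval3_simps)

text \<open>Forms that do not vanish at p become units at the origin, so one direction is clearing
  denominators. For the other, the affine relation is lifted to forms U A = S F + T G, and powers of
  \<open>L\<close> serve as denominators of the right degrees.\<close>

lemma Fract_in_local_ideal_iff:
  assumes F: "homogeneous dF F" and G: "homogeneous dG G"
    and A: "homogeneous e A" and H: "homogeneous e H" "eval3 H p \<noteq> 0"
  shows "Fract A H \<in> local_ideal F G p \<longleftrightarrow> dehom p q r A \<in> loc_ideal (dehom p q r F) (dehom p q r G)"
proof
  assume "Fract A H \<in> local_ideal F G p"
  then obtain A1 H1 A2 H2 HF HG where eq: "Fract A H = Fract A1 H1 * Fract F HF + Fract A2 H2 * Fract G HG"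
    and nz: "eval3 H1 p \<noteq> 0" "eval3 H2 p \<noteq> 0" "eval3 HF p \<noteq> 0" "eval3 HG p \<noteq> 0"
    unfolding local_ideal_def local_ring_def local_equations_def by blast
  note nz' = nz[THEN eval3_nonzero] H(2)[THEN eval3_nonzero]
  have "A * (H1 * HF * (H2 * HG)) = (A1 * F * (H2 * HG) + A2 * G * (H1 * HF)) * H"
    using eq nz' by (simp add: eq_fract)
  then have "dehom p q r (A * (H1 * HF * (H2 * HG))) = dehom p q r ((A1 * F * (H2 * HG) + A2 * G * (H1 * HF)) * H)"
    by (rule arg_cong)
  then have "dehom p q r (H1 * HF * (H2 * HG)) * dehom p q r A
      = dehom p q r (A1 * (H2 * HG) * H) * dehom p q r F + dehom p q r (A2 * (H1 * HF) * H) * dehom p q r G"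
    by (simp add: dehom_simps algebra_simps)
  then show "dehom p q r A \<in> loc_ideal (dehom p q r F) (dehom p q r G)"
    by (rule loc_idealI) (use nz in \<open>simp add: poly_red_dehom_0 eval3_simps\<close>)
next
  assume "dehom p q r A \<in> loc_ideal (dehom p q r F) (dehom p q r G)"
  then obtain u s t where u: "poly (red u) 0 \<noteq> 0"
    and eq: "u * dehom p q r A = s * dehom p q r F + t * dehom p q r G" by (rule loc_idealE)
  obtain eu es et where eu: "\<And>e. e \<ge> eu \<Longrightarrow> \<exists>A. homogeneous e A \<and> dehom p q r A = u"
    and es: "\<And>e. e \<ge> es \<Longrightarrow> \<exists>A. homogeneous e A \<and> dehom p q r A = s"
    and et: "\<And>e. e \<ge> et \<Longrightarrow> \<exists>A. homogeneous e A \<and> dehom p q r A = t"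
    using homogenization by metis
  \<comment> \<open>Large enough for U, S and T to exist in their degrees, and for the subtractions
    of \<open>dF\<close> and \<open>dG\<close> not to be cut off at 0.\<close>
  define k where "k = eu + es + et + dF + dG"
  obtain U where U: "homogeneous k U" "dehom p q r U = u"
    using eu[of k] by (auto simp: k_def)
  obtain S where S: "homogeneous (k + e - dF) S" "dehom p q r S = s"
    using es[of "k + e - dF"] by (auto simp: k_def)
  obtain T where T: "homogeneous (k + e - dG) T" "dehom p q r T = t"
    using et[of "k + e - dG"] by (auto simp: k_def)
  obtain L where L: "homogeneous 1 L" "eval3 L p = 1" by (rule denominator)
  have pow: "homogeneous i (L ^ i)" for i using homogeneous_power[OF L(1), of i] by simp
  have deg: "k + e - dF + dF = k + e" "k + e - dG + dG = k + e" by (simp_all add: k_def)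
  have "U * A = S * F + T * G"
  proof (rule dehom_inj)
    show "homogeneous (k + e) (U * A)" using U(1) A by (rule homogeneous_mult)
    show "homogeneous (k + e) (S * F + T * G)"
      using homogeneous_add homogeneous_mult[OF S(1) F] homogeneous_mult[OF T(1) G] unfolding deg by blast
  qed (simp add: dehom_simps U S T eq)
  have Up: "eval3 U p \<noteq> 0" using u unfolding U(2) [symmetric] poly_red_dehom_0 .
  have nz: "U \<noteq> 0" "H \<noteq> 0" "L ^ i \<noteq> 0" for i
    using Up H(2) L(2) eval3_nonzero[of "L ^ i"] by (auto intro!: eval3_nonzero simp: eval3_simps)
  have UH: "homogeneous (k + e) (U * H)" "eval3 (U * H) p \<noteq> 0"
    using homogeneous_mult[OF U(1) H(1)] Up H(2) by (simp_all add: eval3_simps)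
  have "Fract A H = Fract (S * L ^ dF) (U * H) * Fract F (L ^ dF) + Fract (T * L ^ dG) (U * H) * Fract G (L ^ dG)"
  proof -
    have "Fract (S * L ^ dF) (U * H) * Fract F (L ^ dF) = Fract (S * F) (U * H)"
      "Fract (T * L ^ dG) (U * H) * Fract G (L ^ dG) = Fract (T * G) (U * H)"
      using nz by (simp_all add: eq_fract mult_ac)
    moreover have "Fract (S * F) (U * H) + Fract (T * G) (U * H) = Fract (S * F + T * G) (U * H)"
      using nz by (simp add: eq_fract algebra_simps)
    moreover have "Fract (U * A) (U * H) = Fract A H"
      using nz by (simp add: eq_fract mult_ac)
    ultimately show ?thesis using \<open>U * A = S * F + T * G\<close> by simp
  qed
  moreover have "Fract (S * L ^ dF) (U * H) \<in> local_ring p" "Fract (T * L ^ dG) (U * H) \<in> local_ring p"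
    unfolding local_ring_def using UH homogeneous_mult[OF S(1) pow] homogeneous_mult[OF T(1) pow] deg
    by (metis (mono_tags, lifting) mem_Collect_eq)+
  moreover have "Fract F (L ^ dF) \<in> local_equations F p" "Fract G (L ^ dG) \<in> local_equations G p"
    unfolding local_equations_def using F G pow L(2) by (force simp: eval3_simps)+
  ultimately show "Fract A H \<in> local_ideal F G p"
    unfolding local_ideal_def by blast
qed

lemma common_denominator:
  fixes n :: nat
  assumes "\<And>i. i < n \<Longrightarrow> b i \<in> local_ring p"
  shows "\<exists>e H A. homogeneous e H \<and> eval3 H p \<noteq> 0 \<and> (\<forall>i<n. homogeneous e (A i) \<and> b i = Fract (A i) H)"
  using assms
proof (induction n)
  case 0
  show ?case using homogeneous_const3[of 1] by (intro exI[of _ 0] exI[of _ "const3 1"]) simp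
next
  case (Suc n)
  then obtain e H A where IH: "homogeneous e H" "eval3 H p \<noteq> 0"
    "\<And>i. i < n \<Longrightarrow> homogeneous e (A i) \<and> b i = Fract (A i) H"
    by (metis less_SucI)
  have "b n \<in> local_ring p" using Suc.prems by simp
  then obtain A' H' e' where n: "b n = Fract A' H'" "homogeneous e' A'" "homogeneous e' H'" "eval3 H' p \<noteq> 0"
    unfolding local_ring_def by blast
  have "homogeneous (e + e') (if i < n then A i * H' else H * A') \<and>
      b i = Fract (if i < n then A i * H' else H * A') (H * H')" if "i < Suc n" for i
  proof (cases "i < n")
    case True
    then show ?thesis
      using IH(3)[OF True] homogeneous_mult[of e "A i" e' H'] IH(1,2) n eval3_nonzero by (simp add: eq_fract mult_ac)
  next
    case False
    then have "i = n" using that by simp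
    then show ?thesis
      using homogeneous_mult[OF IH(1) n(2)] IH(1,2) n eval3_nonzero by (simp add: eq_fract mult_ac)
  qed
  moreover have "homogeneous (e + e') (H * H')" "eval3 (H * H') p \<noteq> 0"
    using homogeneous_mult[OF IH(1) n(3)] IH(2) n(4) by (simp_all add: eval3_simps)
  ultimately show ?case
    by (intro exI[of _ "e + e'"] exI[of _ "H * H'"] exI[of _ "\<lambda>i. if i < n then A i * H' else H * A'"]) auto
qed

lemma sum_Fract:
  fixes n :: nat
  assumes "H \<noteq> (0 :: poly3)"
  shows "(\<Sum>i<n. Fract (const3 (c i)) 1 * Fract (A i) H) = Fract (\<Sum>i<n. const3 (c i) * A i) H"
proof (induction n)
  case 0
  show ?case using assms by (simp add: Zero_fract_def eq_fract)
next
  case (Suc n)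
  then show ?case using assms by (simp add: eq_fract algebra_simps)
qed

lemma dehom_sum: "dehom p q r (\<Sum>i<n. const3 (c i) * A i) = (\<Sum>i<n. smult [:c i:] (dehom p q r (A i)))"
  by (simp add: is_hom_sum[OF is_hom_dehom] dehom_simps)

text \<open>A repeated member would give a relation with coefficients 1 and -1. As
  \<open>quotient_dim\<close> counts sets, injectivity is what preserves the number of
  elements.\<close>

lemma indep_mod_inj_on:
  assumes "indep_mod (loc_ideal g h) n b"
  shows "inj_on b {..<n}"
proof (rule inj_onI, rule ccontr)
  fix i j assume ij: "i \<in> {..<n}" "j \<in> {..<n}" "b i = b j" "i \<noteq> j"
  define c :: "nat \<Rightarrow> complex" where "c = (\<lambda>k. if k = i then 1 else if k = j then - 1 else 0)"
  have "(\<Sum>k<n. smult [:c k:] (b k)) = (\<Sum>k\<in>{i, j}. smult [:c k:] (b k))"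
    using ij by (intro sum.mono_neutral_right) (auto simp: c_def)
  also have "\<dots> = 0"
    using ij by (simp add: c_def flip: smult_add_left)
  finally have "(\<Sum>k<n. smult [:c k:] (b k)) \<in> loc_ideal g h"
    by (simp add: loc_idealI[of 1 _ 0 _ 0] red_simps)
  then have "c i = 0" using assms ij unfolding indep_mod_def by blast
  then show False by (simp add: c_def)
qed

text \<open>Finitely many elements of the local ring have a common denominator, which is a unit, so the
  dimension of the quotient can be tested on polynomials.\<close>

theorem intersection_number_eq_mult:
  assumes F: "homogeneous dF F" and G: "homogeneous dG G"
  shows "intersection_number F G p = loc_mult (dehom p q r F) (dehom p q r G)"
proof (rule antisym)
  let ?W = "local_ideal F G p" and ?I = "loc_ideal (dehom p q r F) (dehom p q r G)"
  note mem = Fract_in_local_ideal_iff[OF F G]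
  have hom_sum: "homogeneous e (\<Sum>i<n. const3 (c i) * A i)" if "\<And>i. i < n \<Longrightarrow> homogeneous e (A i)"
    for e n c and A :: "nat \<Rightarrow> poly3"
    using that by (intro homogeneous_sum homogeneous_const3_mult) auto
  show "intersection_number F G p \<le> loc_mult (dehom p q r F) (dehom p q r G)"
    unfolding intersection_number_def quotient_dim_def
  proof (rule SUP_least, clarify)
    fix B assume B: "finite B" "B \<subseteq> local_ring p"
      and ind: "\<forall>c. (\<Sum>b\<in>B. Fract (const3 (c b)) 1 * b) \<in> ?W \<longrightarrow> (\<forall>b\<in>B. c b = 0)"
    define n where "n = card B"
    obtain b where "bij_betw b {0..<n} B"
      using ex_bij_betw_nat_finite[OF B(1)] unfolding n_def by blast
    then have b: "bij_betw b {..<n} B" by (simp add: lessThan_atLeast0)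
    have "b i \<in> local_ring p" if "i < n" for i
      using that b B(2) by (auto simp: bij_betw_def)
    then obtain e H A where H: "homogeneous e H" "eval3 H p \<noteq> 0"
      and A: "\<And>i. i < n \<Longrightarrow> homogeneous e (A i)" "\<And>i. i < n \<Longrightarrow> b i = Fract (A i) H"
      using common_denominator[of n b] by blast
    have "indep_mod ?I n (\<lambda>i. dehom p q r (A i))"
      unfolding indep_mod_def
    proof (intro allI impI)
      fix c i assume c: "(\<Sum>i<n. smult [:c i:] (dehom p q r (A i))) \<in> ?I" and i: "i < n"
      define c' where "c' x = c (inv_into {..<n} b x)" for x
      have c': "c' (b i) = c i" if "i < n" for i
        using that b by (simp add: c'_def bij_betw_def)
      have "Fract (\<Sum>i<n. const3 (c i) * A i) H \<in> ?W"
        using c mem[OF hom_sum[OF A(1)] H] by (simp only: dehom_sum)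
      also have "Fract (\<Sum>i<n. const3 (c i) * A i) H = (\<Sum>i<n. Fract (const3 (c' (b i))) 1 * b i)"
        unfolding sum_Fract[OF eval3_nonzero[OF H(2)], symmetric]
        by (intro sum.cong refl) (simp add: c' flip: A(2))
      also have "\<dots> = (\<Sum>x\<in>B. Fract (const3 (c' x)) 1 * x)"
        by (rule sum.reindex_bij_betw[OF b])
      finally have "\<forall>x\<in>B. c' x = 0" using ind by blast
      then show "c i = 0" using c'[OF i] i b by (metis bij_betwE lessThan_iff)
    qed
    then show "enat (card B) \<le> loc_mult (dehom p q r F) (dehom p q r G)"
      unfolding n_def by (rule loc_mult_geI)
  qed
  show "loc_mult (dehom p q r F) (dehom p q r G) \<le> intersection_number F G p"
  proof (rule loc_mult_leI)
    fix n a assume a: "indep_mod ?I n a"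
    have "\<forall>i. \<exists>e0. \<forall>e\<ge>e0. \<exists>A. homogeneous e A \<and> dehom p q r A = a i"
      using homogenization by blast
    from choice[OF this] obtain e0
      where e0: "\<And>i e. e \<ge> e0 i \<Longrightarrow> \<exists>A. homogeneous e A \<and> dehom p q r A = a i" by blast
    \<comment> \<open>The sum bounds every \<open>e0 i\<close>, so all members can be lifted in one
      degree and share the denominator \<open>L ^ e\<close>.\<close>
    define e where "e = (\<Sum>i<n. e0 i)"
    have "e0 i \<le> e" if "i < n" for i
      unfolding e_def using that by (intro member_le_sum) auto
    then have "\<forall>i. \<exists>A. i < n \<longrightarrow> homogeneous e A \<and> dehom p q r A = a i"
      using e0 by blast
    from choice[OF this] obtain A
      where A: "\<And>i. i < n \<Longrightarrow> homogeneous e (A i)" "\<And>i. i < n \<Longrightarrow> dehom p q r (A i) = a i" by blast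
    obtain L where L: "homogeneous 1 L" "eval3 L p = 1" by (rule denominator)
    define H where "H = L ^ e"
    have H: "homogeneous e H" "eval3 H p \<noteq> 0"
      using homogeneous_power[OF L(1), of e] L(2) by (simp_all add: H_def eval3_simps)
    note H0 = eval3_nonzero[OF H(2)]
    define b where "b i = Fract (A i) H" for i
    have inj: "inj_on b {..<n}"
    proof (rule inj_onI)
      fix i j assume ij: "i \<in> {..<n}" "j \<in> {..<n}" "b i = b j"
      then have "A i = A j" using H0 by (simp add: b_def eq_fract)
      then have "a i = a j" using A(2) ij by (metis lessThan_iff)
      then show "i = j" using indep_mod_inj_on[OF a] ij by (simp add: inj_on_def)
    qed
    have "enat (card (b ` {..<n})) \<le> intersection_number F G p"
      unfolding intersection_number_def quotient_dim_def
    proof (rule SUP_upper, intro CollectI conjI allI impI ballI)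
      show "b ` {..<n} \<subseteq> local_ring p"
        unfolding local_ring_def b_def using A(1) H by auto
    next
      fix c x assume "(\<Sum>b\<in>b ` {..<n}. Fract (const3 (c b)) 1 * b) \<in> ?W" and x: "x \<in> b ` {..<n}"
      then have "Fract (\<Sum>i<n. const3 (c (b i)) * A i) H \<in> ?W"
        unfolding sum_Fract[OF H0, symmetric] sum.reindex[OF inj] by (simp add: b_def)
      then have "dehom p q r (\<Sum>i<n. const3 (c (b i)) * A i) \<in> ?I"
        using mem[OF hom_sum[OF A(1)] H] by simp
      also have "dehom p q r (\<Sum>i<n. const3 (c (b i)) * A i) = (\<Sum>i<n. smult [:c (b i):] (a i))"
        unfolding dehom_sum by (intro sum.cong) (simp_all add: A(2))
      finally have "\<forall>i<n. c (b i) = 0" using a unfolding indep_mod_def by (elim allE[of _ "\<lambda>i. c (b i)"]) simp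
      then show "c x = 0" using x by auto
    qed simp
    then show "enat n \<le> intersection_number F G p" by (simp add: card_image[OF inj])
  qed
qed

end

section \<open>Independence of the Milnor number of the choice of polars\<close>

lemma homogeneous_polar: "homogeneous d F \<Longrightarrow> homogeneous (d - 1) (polar F q)"
  unfolding polar_def by (intro homogeneous_add homogeneous_const3_mult homogeneous_derivs)

lemma polar_linear: "polar F (a *s q + b *s r) = const3 a * polar F q + const3 b * polar F r"
  by (simp add: polar_def is_homD[OF is_hom_const3] algebra_simps)

lemma collinear3_swap: "collinear3 p q r \<longleftrightarrow> collinear3 p r q"
  by (simp add: collinear3_def insert_commute)

lemma intersection_number_commute: "intersection_number F G p = intersection_number G F p"
proof -
  have "local_ideal F G p = local_ideal G F p"
    unfolding local_ideal_def by (auto simp: add.commute) (metis add.commute)+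
  then show ?thesis by (simp add: intersection_number_def)
qed

lemma loc_mult_linear_combination:
  assumes "\<alpha> \<noteq> 0"
  shows "loc_mult ([:[:\<alpha>:]:] * g + [:[:\<beta>:]:] * h) h = loc_mult g h"
proof (rule loc_mult_cong)
  show "[:[:\<alpha>:]:] * g + [:[:\<beta>:]:] * h \<in> loc_ideal g h"
    by (rule loc_idealI[of 1 _ "[:[:\<alpha>:]:]" _ "[:[:\<beta>:]:]"]) (simp_all add: red_simps)
  have "[:[:\<alpha>:]:] * g = 1 * ([:[:\<alpha>:]:] * g + [:[:\<beta>:]:] * h) + (- [:[:\<beta>:]:]) * h"
    by (simp only: mult_1_left mult_minus_left) simp
  then show "g \<in> loc_ideal ([:[:\<alpha>:]:] * g + [:[:\<beta>:]:] * h) h"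
    by (rule loc_idealI) (simp add: red_def map_poly_pCons assms)
qed (rule loc_ideal_generators)+

context frame
begin

lemma swap: "frame p r q"
  using not_collinear collinear3_swap by (simp add: frame_def)

lemma not_collinear_combination:
  assumes "v = a *s p + b *s q + c *s r" "c \<noteq> 0"
  shows "frame p q v"
proof
  show "\<not> collinear3 p q v"
  proof
    assume "collinear3 p q v"
    then obtain w where w: "w \<noteq> 0" "\<And>x. x \<in> {p, q, v} \<Longrightarrow> (\<Sum>i\<in>UNIV. w $ i * x $ i) = 0"
      unfolding collinear3_def by blast
    have "(\<Sum>i\<in>UNIV. w $ i * v $ i) = a * (\<Sum>i\<in>UNIV. w $ i * p $ i)
        + b * (\<Sum>i\<in>UNIV. w $ i * q $ i) + c * (\<Sum>i\<in>UNIV. w $ i * r $ i)"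
      unfolding assms(1) by (simp add: sum_3 algebra_simps)
    then have "(\<Sum>i\<in>UNIV. w $ i * r $ i) = 0"
      using w(2) assms(2) by simp
    then show False
      using w not_collinear unfolding collinear3_def by blast
  qed
qed

text \<open>The assumption \<open>good\<close> says that C does not contain the line pq, so that
  f(y, 0) is nonzero and Teissier's formula is available.\<close>

lemma intersection_polar:
  assumes F: "homogeneous d F" and p: "eval3 F p = 0" and good: "eval3 F (p + a *s q) \<noteq> 0"
  shows "intersection_number (polar F q) F p
    = enat (order 0 (red (pderiv (dehom p q r F)))) + intersection_number (polar F q) (polar F r) p"
proof -
  let ?f = "dehom p q r F"
  have "red ?f \<noteq> 0"
    using good poly_red_dehom[of p q r F a] by auto
  moreover have "poly (red ?f) 0 = 0"
    using p by (simp add: poly_red_dehom_0)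
  ultimately show ?thesis
    using loc_mult_polar(1)[of ?f] homogeneous_polar[OF F] F
    by (simp add: intersection_number_eq_mult[of "d - 1" _ d] intersection_number_eq_mult[of "d - 1" _ "d - 1"]
        pderiv_dehom d_z_dehom)
qed

text \<open>The order in \<open>intersection_polar\<close> depends only on F along the line pq, so
  it is the same for r and r'. Being finite, it can be cancelled even if the intersection numbers
  are infinite.\<close>

lemma polar_pair_cong:
  assumes F: "homogeneous d F" and p: "eval3 F p = 0" and good: "eval3 F (p + a *s q) \<noteq> 0"
    and r': "frame p q r'"
  shows "intersection_number (polar F q) (polar F r) p = intersection_number (polar F q) (polar F r') p"
proof -
  have "red (dehom p q r F) = red (dehom p q r' F)"
    unfolding poly_eq_poly_eq_iff [symmetric] by (rule ext) (simp add: poly_red_dehom)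
  then show ?thesis
    using intersection_polar[OF F p good] frame.intersection_polar[OF r' F p good]
    by (simp add: red_pderiv)
qed

lemma general_vector:
  assumes "F \<noteq> 0"
  obtains v where "eval3 F v \<noteq> 0"
  using poly3_eq_0[of F] assms by blast

lemma polar_pair_combination:
  assumes F: "homogeneous d F" and "b \<noteq> 0"
  shows "frame p (b *s q + c *s r) r"
    and "intersection_number (polar F (b *s q + c *s r)) (polar F r) p = intersection_number (polar F q) (polar F r) p"
proof -
  have "b *s q + c *s r = 0 *s p + c *s r + b *s q" by (simp add: add.commute)
  then show "frame p (b *s q + c *s r) r"
    using frame.not_collinear_combination[OF swap] \<open>b \<noteq> 0\<close> frame.swap by blast
  note hom = homogeneous_polar[OF F]
  show "intersection_number (polar F (b *s q + c *s r)) (polar F r) p = intersection_number (polar F q) (polar F r) p"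
    using loc_mult_linear_combination[OF \<open>b \<noteq> 0\<close>, of "dehom p q r (polar F q)" c "dehom p q r (polar F r)"]
    unfolding intersection_number_eq_mult[OF hom hom] by (simp add: polar_linear dehom_simps)
qed

text \<open>Teissier's formula needs a direction whose line through p is not inside C. A point v off
  C supplies one as its component b q + c r; completed by r or by q, it leaves the span of the two
  polars unchanged.\<close>

lemma good_polar_pair:
  assumes F: "homogeneous d F" "F \<noteq> 0" and p: "eval3 F p = 0"
  obtains q1 r1 a where "frame p q1 r1" "eval3 F (p + a *s q1) \<noteq> 0"
    "intersection_number (polar F q) (polar F r) p = intersection_number (polar F q1) (polar F r1) p"
proof -
  obtain l m n where l: "eval3 (lin l) p = 1"
    and dec: "\<And>v. v = eval3 (lin l) v *s p + eval3 (lin m) v *s q + eval3 (lin n) v *s r"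
    by (rule dual_basis) blast
  \<comment> \<open>The factor \<open>lin l\<close> forces v to have a nonzero p-coordinate, so that
    v is a multiple of some p + (1/a) q1.\<close>
  have "F * lin l \<noteq> 0" using F(2) l by (auto simp: eval3_simps)
  then obtain v where "eval3 (F * lin l) v \<noteq> 0" by (rule general_vector)
  then have v: "eval3 F v \<noteq> 0" "eval3 (lin l) v \<noteq> 0" by (auto simp: eval3_simps)
  define a b c where "a = eval3 (lin l) v" and "b = eval3 (lin m) v" and "c = eval3 (lin n) v"
  define q1 where "q1 = b *s q + c *s r"
  have "v = a *s (p + (1 / a) *s q1)"
    using v(2) dec[of v] by (simp add: a_def b_def c_def q1_def vector_add_ldistrib vector_smult_assoc add.assoc)
  then have good: "eval3 F (p + (1 / a) *s q1) \<noteq> 0"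
    using v(1) eval3_scale[OF F(1)] by (metis mult_zero_right)
  then have "b \<noteq> 0 \<or> c \<noteq> 0" using p by (auto simp: q1_def)
  then show thesis
  proof
    assume "b \<noteq> 0"
    from polar_pair_combination[OF F(1) this, of c] show thesis
      using good by (intro that[of q1 r "1 / a"]) (simp_all add: q1_def)
  next
    assume "c \<noteq> 0"
    from frame.polar_pair_combination[OF swap F(1) this, of b] show thesis
      using good by (intro that[of q1 q "1 / a"])
        (simp_all add: q1_def add.commute intersection_number_commute[of "polar F r"])
  qed
qed

end

text \<open>A third direction q3 links the pairs: (q, r), (q, q3), (q', q3), (q', r'). Each passage
  keeps one good member, so \<open>polar_pair_cong\<close> applies to it.\<close>

lemma good_polar_pairs_agree:
  assumes F: "homogeneous d F" "F \<noteq> 0" and p: "eval3 F p = 0"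
    and fr: "frame p q r" "frame p q' r'"
    and good: "eval3 F (p + a *s q) \<noteq> 0" "eval3 F (p + a' *s q') \<noteq> 0"
  shows "intersection_number (polar F q) (polar F r) p = intersection_number (polar F q') (polar F r') p"
proof -
  obtain l m n where l: "eval3 (lin l) p = 1" and n: "eval3 (lin n) r = 1"
    and dec: "\<And>v. v = eval3 (lin l) v *s p + eval3 (lin m) v *s q + eval3 (lin n) v *s r"
    by (rule frame.dual_basis[OF fr(1)]) blast
  obtain l' m' n' where n': "eval3 (lin n') r' = 1"
    and dec': "\<And>v. v = eval3 (lin l') v *s p + eval3 (lin m') v *s q' + eval3 (lin n') v *s r'"
    by (rule frame.dual_basis[OF fr(2)]) blast
  \<comment> \<open>A point v where the product is nonzero lies off C. The factor for l makes v a
    multiple of p + (1/c) q3; those for n and n' keep q3 off the lines pq and pq'.\<close>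
  have "F * lin l * lin n * lin n' \<noteq> 0" using F(2) l n n' by (auto simp: eval3_simps)
  then obtain v where "eval3 (F * lin l * lin n * lin n') v \<noteq> 0"
    by (rule frame.general_vector[OF fr(1)])
  then have v: "eval3 F v \<noteq> 0" "eval3 (lin l) v \<noteq> 0" "eval3 (lin n) v \<noteq> 0" "eval3 (lin n') v \<noteq> 0"
    by (auto simp: eval3_simps)
  define c where "c = eval3 (lin l) v"
  define q3 where "q3 = v - c *s p"
  have "v = c *s (p + (1 / c) *s q3)"
    using v(2) by (simp add: c_def q3_def vector_add_ldistrib vector_smult_assoc)
  then have good3: "eval3 F (p + (1 / c) *s q3) \<noteq> 0"
    using v(1) eval3_scale[OF F(1)] by (metis mult_zero_right)
  have "q3 = 0 *s p + eval3 (lin m) v *s q + eval3 (lin n) v *s r"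
    unfolding q3_def c_def by (subst dec[of v]) simp
  then have fr3: "frame p q q3"
    by (rule frame.not_collinear_combination[OF fr(1)]) (rule v)
  have "q3 = (eval3 (lin l') v - c) *s p + eval3 (lin m') v *s q' + eval3 (lin n') v *s r'"
    unfolding q3_def by (subst dec'[of v]) (simp add: vector_sub_rdistrib)
  then have fr3': "frame p q' q3"
    by (rule frame.not_collinear_combination[OF fr(2)]) (rule v)
  note fr3s = frame.swap[OF fr3] frame.swap[OF fr3']
  have "intersection_number (polar F q) (polar F r) p = intersection_number (polar F q) (polar F q3) p"
    by (rule frame.polar_pair_cong[OF fr(1) F(1) p good(1) fr3])
  also have "\<dots> = intersection_number (polar F q3) (polar F q) p"
    by (rule intersection_number_commute)
  also have "\<dots> = intersection_number (polar F q3) (polar F q') p"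
    by (rule frame.polar_pair_cong[OF fr3s(1) F(1) p good3 fr3s(2)])
  also have "\<dots> = intersection_number (polar F q') (polar F q3) p"
    by (rule intersection_number_commute)
  also have "\<dots> = intersection_number (polar F q') (polar F r') p"
    by (rule frame.polar_pair_cong[OF fr3' F(1) p good(2) fr(2)])
  finally show ?thesis .
qed

text \<open>Any two admissible pairs can be replaced by good ones, and these agree, so the
  description in \<open>milnor_number\<close> has exactly one solution.\<close>

lemma milnor_number_eq:
  assumes F: "homogeneous d F" "F \<noteq> 0" and p: "eval3 F p = 0" and fr: "frame p q r"
  shows "milnor_number F p = intersection_number (polar F q) (polar F r) p"
  unfolding milnor_number_def
proof (rule the_equality, intro allI impI)
  fix q' q'' assume "\<not> collinear3 p q' q''"
  then have fr': "frame p q' q''" by (simp add: frame_def)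
  obtain q1 r1 a where 1: "frame p q1 r1" "eval3 F (p + a *s q1) \<noteq> 0"
    "intersection_number (polar F q) (polar F r) p = intersection_number (polar F q1) (polar F r1) p"
    by (rule frame.good_polar_pair[OF fr F p])
  obtain q2 r2 b where 2: "frame p q2 r2" "eval3 F (p + b *s q2) \<noteq> 0"
    "intersection_number (polar F q') (polar F q'') p = intersection_number (polar F q2) (polar F r2) p"
    by (rule frame.good_polar_pair[OF fr' F p])
  show "intersection_number (polar F q) (polar F r) p = intersection_number (polar F q') (polar F q'') p"
    unfolding 1(3) 2(3) by (rule good_polar_pairs_agree[OF F p 1(1) 2(1) 1(2) 2(2)])
qed (use fr in \<open>auto simp: frame_def\<close>)

text \<open>Up to scaling the points p + a q are all points of z = 0 with l nonzero. If F vanished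
  on them, F l would vanish on the whole line; since l(p) = 1, the restriction of F to z = 0 would
  be 0 and z would divide F.\<close>

lemma (in frame) line_at_infinity_good:
  assumes F: "homogeneous d F" "\<not> varz dvd F" and "p $ 3 = 0" "q $ 3 = 0" "r $ 3 = 1"
  shows "\<exists>a. eval3 F (p + a *s q) \<noteq> 0"
proof (rule ccontr)
  assume "\<nexists>a. eval3 F (p + a *s q) \<noteq> 0"
  then have zero: "eval3 F (p + a *s q) = 0" for a by blast
  obtain l m n where l: "eval3 (lin l) p = 1"
    and dec: "\<And>v. v = eval3 (lin l) v *s p + eval3 (lin m) v *s q + eval3 (lin n) v *s r"
    by (rule dual_basis) blast
  have ev: "eval3 G v = poly (poly (coeff G 0) [:v $ 2:]) (v $ 1)" if "v $ 3 = 0" for G and v :: "complex ^ 3"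
    using that by (simp add: eval3_def flip: poly_0_coeff_0)
  have "eval3 (F * lin l) v = 0" if "v $ 3 = 0" for v :: "complex ^ 3"
  proof (cases "eval3 (lin l) v = 0")
    case False
    let ?c = "eval3 (lin l) v"
    have "eval3 (lin n) v = 0"
      using arg_cong[OF dec[of v], of "\<lambda>w :: complex ^ 3. w $ 3"] that assms(3-5) by simp
    then have "v = ?c *s (p + (eval3 (lin m) v / ?c) *s q)"
      using False dec[of v] by (simp add: vector_add_ldistrib vector_smult_assoc)
    then have "eval3 F v = 0"
      using eval3_scale[OF F(1)] zero by (metis mult_zero_right)
    then show ?thesis by (simp add: eval3_simps)
  qed (simp add: eval3_simps)
  then have "poly (poly (coeff (F * lin l) 0) [:y:]) x = 0" for x y
    using ev[of "vector [x, y, 0]" "F * lin l"] by simp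
  then have "poly (coeff (F * lin l) 0) [:y:] = 0" for y
    by (metis poly_all_0_iff_0)
  then have "coeff (F * lin l) 0 = 0"
    by (intro poly_eq_0_if_infinite_roots[of "\<lambda>y. [:y:]"]) (auto simp: inj_def)
  moreover have "coeff (lin l) 0 \<noteq> 0"
    using ev[of p "lin l"] l assms(3) by auto
  ultimately have "coeff F 0 = 0"
    by (simp add: coeff_mult_0)
  then have "varz dvd F"
    using poly_eq_0_iff_dvd[of F 0] by (simp add: varz_def poly_0_coeff_0)
  then show False using F(2) by contradiction
qed

theorem proposition2p5:
  fixes F :: poly3 and d :: nat and p :: "complex ^ 3"
  assumes "homogeneous d F"
    and "\<not> varz dvd F"
    and "p \<noteq> 0"
    and "eval3 F p = 0"
    and "p $ 3 = 0"
  shows "intersection_number (Dx F) (Dy F) p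
           \<ge> milnor_number F p + intersection_number F varz p - 1"
proof -
  \<comment> \<open>The vector q is a coordinate point of the line at infinity different from p, and
    r lies off that line. In this chart the equation of the line at infinity is the coordinate
    z.\<close>
  define q :: "complex ^ 3" where "q = (if p $ 1 \<noteq> 0 then vector [0, 1, 0] else vector [1, 0, 0])"
  define r :: "complex ^ 3" where "r = vector [0, 0, 1]"
  have F0: "F \<noteq> 0" using assms(2) by auto
  have p12: "p $ 1 \<noteq> 0 \<or> p $ 2 \<noteq> 0"
    using assms(3,5) by (auto simp: vec_eq_iff forall_3)
  interpret frame p q r
  proof
    show "\<not> collinear3 p q r"
    proof
      assume "collinear3 p q r"
      then obtain w where "w \<noteq> 0" and w: "(\<Sum>i\<in>UNIV. w $ i * p $ i) = 0"
        "(\<Sum>i\<in>UNIV. w $ i * q $ i) = 0" "(\<Sum>i\<in>UNIV. w $ i * r $ i) = 0"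
        unfolding collinear3_def by auto
      have "w $ 1 = 0 \<and> w $ 2 = 0 \<and> w $ 3 = 0"
        using w p12 assms(5) by (auto simp: q_def r_def sum_3 split: if_splits)
      then show False
        using \<open>w \<noteq> 0\<close> by (simp add: vec_eq_iff forall_3)
    qed
  qed
  have coords: "q $ 3 = 0" "r $ 3 = 1" by (simp_all add: q_def r_def)
  define f where "f = dehom p q r F"
  obtain a where "eval3 F (p + a *s q) \<noteq> 0"
    using line_at_infinity_good[OF assms(1,2,5) coords] by blast
  then have red0: "red f \<noteq> 0" "poly (red f) 0 = 0"
    using poly_red_dehom[of p q r F a] assms(4) by (auto simp: f_def poly_red_dehom_0)
  define \<rho> where "\<rho> = order 0 (red (pderiv f))"
  define M where "M = loc_mult (pderiv f) (d_z f)"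
  note hom = homogeneous_polar[OF assms(1)]
  have "milnor_number F p = M"
    unfolding milnor_number_eq[OF assms(1) F0 assms(4) frame_axioms] intersection_number_eq_mult[OF hom hom]
    by (simp add: M_def f_def pderiv_dehom d_z_dehom)
  moreover have "intersection_number F varz p = enat (Suc \<rho>)"
  proof -
    have "intersection_number F varz p = loc_mult f (var_z * 1)"
      unfolding intersection_number_eq_mult[OF assms(1) homogeneous_vars(3)]
      by (simp add: f_def affine_coord_def assms(5) coords)
    also obtain u where "red f = [:0, 1:] ^ order 0 (red f) * u" "poly u 0 \<noteq> 0"
      by (rule red_eq_X_power_mult[OF red0(1)])
    then have "loc_mult f (var_z * 1) = enat (order 0 (red f)) + loc_mult f 1"
      by (rule loc_mult_var_z)
    also have "loc_mult f 1 = 0"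
      using loc_mult_unit[of 1 f] by (simp add: loc_mult_commute red_simps)
    finally show ?thesis
      using order_red_pderiv(2)[OF red0] by (simp add: \<rho>_def)
  qed
  moreover have "enat \<rho> + M \<le> intersection_number (Dx F) (Dy F) p"
  proof -
    let ?x = "dehom p q r (Dx F)" and ?y = "dehom p q r (Dy F)" and ?p = "dehom p q r (polar F p)"
    \<comment> \<open>As p lies on z = 0, its polar combines only F_x and F_y. By the choice of q,
      f_y is one of these two, and the other one has a nonzero coefficient in the polar at p, so the
      ideals coincide.\<close>
    have pol: "?p = [:[:p $ 1:]:] * ?x + [:[:p $ 2:]:] * ?y"
      unfolding dehom_polar by (simp add: assms(5))
    have "intersection_number (Dx F) (Dy F) p = loc_mult ?x ?y"
      by (rule intersection_number_eq_mult[OF homogeneous_derivs(1,2)[OF assms(1)]])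
    also have "\<dots> = loc_mult (pderiv f) ?p"
    proof (cases "p $ 1 = 0")
      case False
      then have "pderiv f = ?y"
        unfolding f_def pderiv_dehom dehom_polar by (simp add: q_def flip: one_pCons)
      then show ?thesis
        using loc_mult_linear_combination[OF False, of ?x "p $ 2" ?y] unfolding pol by (simp only: loc_mult_commute)
    next
      case True
      then have p2: "p $ 2 \<noteq> 0" and "pderiv f = ?x"
        using p12 unfolding f_def pderiv_dehom dehom_polar by (simp_all add: q_def flip: one_pCons)
      then show ?thesis
        using loc_mult_linear_combination[OF p2, of ?y "p $ 1" ?x] unfolding pol
        by (simp only: loc_mult_commute add.commute)
    qed
    also have "enat \<rho> + M \<le> \<dots>"
      unfolding M_def \<rho>_def dehom_polar_base_point[OF assms(1)] f_def [symmetric]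
      by (rule loc_mult_polar(2)[OF red0])
    finally show ?thesis .
  qed
  \<comment> \<open>Subtraction in \<open>enat\<close>: the finite summand is at least 1, so nothing
    is cut off, and an infinite \<open>M\<close> stays infinite.\<close>
  moreover have "M + enat (Suc \<rho>) - 1 = enat \<rho> + M"
    by (cases M) (simp_all add: one_enat_def)
  ultimately show ?thesis by simp
qed

end
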